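(* Let $X\in L^1(\mathbb{P}_0)$, let $\phi_1,\phi_2,\phi_3\in\Phi_0$ be lower-semicontinuous, and let $r>0$. Define the globalized robust OCE risk measure $$\rho^g_{\mathrm{oce},\mathbb{P}_0}(X)= \sup_{\{\mathbb{P}:I_{\phi_3}(\mathbb{P},\mathbb{P}_0)\leq r\}}\ \sup_{\{\mathbb{Q}:\mathbb{Q}\ll \mathbb{P}\}}\ \sup_{\{\bar{\mathbb{Q}}:\bar{\mathbb{Q}}\ll \mathbb{Q}\}}\mathbb{E}_{\bar{\mathbb{Q}}}[-X]-I_{\phi_1}(\bar{\mathbb{Q}},\mathbb{Q})-I_{\phi_2}(\mathbb{Q},\mathbb{P}).$$ Then $$\rho^g_{\mathrm{oce},\mathbb{P}_0}(X)=\inf_{\lambda\geq 0,\ \theta_1,\theta_2,\theta_3\in\mathbb{R}}\left\{-\theta_1-\theta_2-\theta_3+\lambda r+\mathbb{E}_{\mathbb{P}_0}\left[\lambda \phi_3^*\left(\frac{\phi_2^*(\phi_1^*(\theta_3-X)+\theta_2)+\theta_1}{\lambda}\right)\right]\right\}.$$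
   Context: $\mathbb{P}_0$ is a given (nominal) probability measure on a measurable space $(\Omega,\mathcal{F})$; $\mathbb{P},\mathbb{Q},\bar{\mathbb{Q}}$ range over probability measures. $\Phi_0$ is the set of all convex functions $\phi:\mathbb{R}\to[0,\infty]$ with $\phi(1)=0$ whose effective domain $\{t:\phi(t)<\infty\}$ is contained in $[0,\infty)$ and contains a neighborhood of $1$. $I_\phi(\mathbb{Q},\mathbb{P})=\int_\Omega\phi\left(\frac{\mathrm{d}\mathbb{Q}}{\mathrm{d}\mathbb{P}}\right)\mathrm{d}\mathbb{P}$ if $\mathbb{Q}\ll\mathbb{P}$, and $+\infty$ otherwise. Conventions: $\phi(0)=\lim_{t\downarrow0}\phi(t)$, $0\phi(0/0)=0$, $0\phi(a/0)=a\lim_{t\to\infty}\phi(t)/t$ for $a>0$. $\phi^*(s)=\sup_{t\in\mathbb{R}}\{st-\phi(t)\}$ is the convex conjugate. Convention for $\lambda=0$: $0\phi^*(s/0)=0$ if $s\le0$ and $+\infty$ if $s>0$. *)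

theory Defs
  imports "HOL-Probability.Probability"
begin

definition prob_measures_on :: "'a measure \<Rightarrow> 'a measure set" where
  "prob_measures_on M = {P. prob_space P \<and> sets P = sets M}"

definition eff_dom :: "(real \<Rightarrow> ennreal) \<Rightarrow> real set" where
  "eff_dom \<phi> = {t. \<phi> t < \<infinity>}"

text \<open>The library's convexity predicate \<^const>\<open>convex_on\<close> is restricted to real-valued functions.\<close>

definition ext_convex :: "(real \<Rightarrow> ennreal) \<Rightarrow> bool" where
  "ext_convex \<phi> \<longleftrightarrow>
     (\<forall>x y u v. 0 \<le> u \<longrightarrow> 0 \<le> v \<longrightarrow> u + v = 1 \<longrightarrow>
        \<phi> (u * x + v * y) \<le> ennreal u * \<phi> x + ennreal v * \<phi> y)"

definition lower_semicont :: "(real \<Rightarrow> ennreal) \<Rightarrow> bool" where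
  "lower_semicont \<phi> \<longleftrightarrow> (\<forall>t. \<phi> t \<le> Liminf (at t) \<phi>)"

definition Phi0 :: "(real \<Rightarrow> ennreal) set" where
  "Phi0 = {\<phi>. ext_convex \<phi> \<and> \<phi> 1 = 0 \<and> eff_dom \<phi> \<subseteq> {0..} \<and> 1 \<in> interior (eff_dom \<phi>)}"

text \<open>
  Argument order: \<open>absolutely_continuous P Q\<close> says that \<open>Q\<close> is absolutely continuous with
  respect to \<open>P\<close>. The derivative \<open>RN_deriv P Q\<close> is \<open>P\<close>-almost everywhere finite for
  probability measures, so \<open>enn2real\<close> only changes it on a null set. For lower-semicontinuous
  members of \<open>Phi0\<close> the convention that \<open>\<phi> 0\<close> is the limit of \<open>\<phi>\<close> from the right
  holds automatically.
\<close>

definition phi_divergence :: "(real \<Rightarrow> ennreal) \<Rightarrow> 'a measure \<Rightarrow> 'a measure \<Rightarrow> ennreal" where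
  "phi_divergence \<phi> Q P =
     (if absolutely_continuous P Q
      then \<integral>\<^sup>+ \<omega>. \<phi> (enn2real (RN_deriv P Q \<omega>)) \<partial>P
      else \<infinity>)"

text \<open>
  The argument is extended-real so that conjugates can be nested. The value \<open>-\<infinity>\<close> never
  arises as an inner value, and at \<open>\<infinity>\<close> the conjugate of a member of \<open>Phi0\<close> is \<open>\<infinity>\<close>;
  see the two lemmas below.
\<close>

definition convex_conjugate :: "(real \<Rightarrow> ennreal) \<Rightarrow> ereal \<Rightarrow> ereal" where
  "convex_conjugate \<phi> s = (SUP t::real. s * ereal t - enn2ereal (\<phi> t))"

lemma convex_conjugate_ge:
  assumes "\<phi> \<in> Phi0"
  shows "s \<le> convex_conjugate \<phi> s"
proof -
  have "s = s * ereal 1 - enn2ereal (\<phi> 1)"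
    using assms by (simp add: Phi0_def zero_ennreal.rep_eq flip: one_ereal_def)
  also have "\<dots> \<le> convex_conjugate \<phi> s"
    unfolding convex_conjugate_def by (rule SUP_upper) simp
  finally show ?thesis .
qed

lemma convex_conjugate_infinity:
  assumes "\<phi> \<in> Phi0"
  shows "convex_conjugate \<phi> \<infinity> = \<infinity>"
  using convex_conjugate_ge[OF assms, of \<infinity>] by simp

text \<open>\<open>\<lambda> \<phi>\<^sup>*(s / \<lambda>)\<close>, with its convention for \<open>\<lambda> = 0\<close>.\<close>

definition conjugate_persp :: "(real \<Rightarrow> ennreal) \<Rightarrow> real \<Rightarrow> ereal \<Rightarrow> ereal" where
  "conjugate_persp \<phi> l s =
     (if l = 0 then (if s \<le> 0 then 0 else \<infinity>)
      else ereal l * convex_conjugate \<phi> (s / ereal l))"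

text \<open>
  Subtraction with \<open>\<infinity> - \<infinity> = -\<infinity>\<close>, the convention for a maximisation problem
  (the library has \<open>\<infinity> - \<infinity> = \<infinity>\<close>).
\<close>

definition lower_minus :: "ereal \<Rightarrow> ereal \<Rightarrow> ereal"  (infixl \<open>\<ominus>\<^sub>l\<close> 65) where
  "a \<ominus>\<^sub>l b = (if b = \<infinity> then -\<infinity> else a - b)"

text \<open>Positive part minus negative part; \<^const>\<open>e2ennreal\<close> maps negative arguments to \<open>0\<close>.\<close>

definition ext_expectation :: "'a measure \<Rightarrow> ('a \<Rightarrow> ereal) \<Rightarrow> ereal" where
  "ext_expectation M f =
     enn2ereal (\<integral>\<^sup>+ \<omega>. e2ennreal (f \<omega>) \<partial>M) \<ominus>\<^sub>l enn2ereal (\<integral>\<^sup>+ \<omega>. e2ennreal (- f \<omega>) \<partial>M)"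

text \<open>
  By the convention in \<open>\<ominus>\<^sub>l\<close>, a triple of measures whose objective is an undefined
  expression \<open>\<infinity> - \<infinity>\<close> does not contribute to the supremum.
\<close>

definition globalized_robust_oce ::
  "(real \<Rightarrow> ennreal) \<Rightarrow> (real \<Rightarrow> ennreal) \<Rightarrow> (real \<Rightarrow> ennreal) \<Rightarrow> real \<Rightarrow> 'a measure \<Rightarrow> ('a \<Rightarrow> real) \<Rightarrow> ereal"
where
  "globalized_robust_oce \<phi>1 \<phi>2 \<phi>3 r P0 X =
     (SUP P \<in> {P \<in> prob_measures_on P0. phi_divergence \<phi>3 P P0 \<le> ennreal r}.
      SUP Q \<in> {Q \<in> prob_measures_on P0. absolutely_continuous P Q}.
      SUP Q' \<in> {Q' \<in> prob_measures_on P0. absolutely_continuous Q Q'}.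
        ext_expectation Q' (\<lambda>\<omega>. ereal (- X \<omega>))
          \<ominus>\<^sub>l enn2ereal (phi_divergence \<phi>1 Q' Q) \<ominus>\<^sub>l enn2ereal (phi_divergence \<phi>2 Q P))"

end

theory Submission
  imports Defs
begin

text \<open>
  Writing \<open>y1, y2, y3\<close> for the densities of \<open>Q', Q, P\<close> with respect to \<open>P0\<close>, the primal problem
  is a concave maximisation with the four scalar constraints \<open>E y1 = E y2 = E y3 = 1\<close> and
  \<open>E \<phi>3(y3) \<le> r\<close>, because the integrands \<open>y2 \<phi>1(y1 / y2)\<close> and \<open>y3 \<phi>2(y2 / y3)\<close> are perspectives of
  convex functions. The inequality \<open>\<le>\<close> is Fenchel's inequality applied three times.
  For \<open>\<ge>\<close> it is enough to use bounded, strictly positive densities: separating hyperplanes in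
  \<open>\<real>\<^sup>5\<close> give multipliers \<open>\<theta>1, \<theta>2, \<theta>3, \<lambda>\<close>, the Slater condition being \<open>r > 0\<close> together with \<open>1\<close>
  being interior to the domains. The supremum of the Lagrangian over these densities is then moved
  inside the expectation: each conjugate is a supremum of countably many affine functions, the
  maximum over finitely many of them is attained by a finitely valued density, and monotone
  convergence applies.
\<close>

section \<open>Regularity of the integrands and countable forms of their conjugates\<close>

text \<open>Strict superlevel sets are open: the limit inferior controls a punctured neighbourhood
  of each of their points, and the point itself is in the set by assumption.\<close>

lemma lower_semicont_measurable:
  assumes "lower_semicont \<phi>"
  shows "\<phi> \<in> borel_measurable borel"
proof (rule borel_measurableI_greater)
  fix a :: ennreal
  have "open {t. a < \<phi> t}"
    unfolding open_subopen[of "{t. a < \<phi> t}"]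
  proof
    fix t assume t: "t \<in> {t. a < \<phi> t}"
    then have "a < Liminf (at t) \<phi>"
      using assms by (auto simp: lower_semicont_def intro: less_le_trans)
    then have "eventually (\<lambda>s. a < \<phi> s) (at t)"
      by (rule less_LiminfD)
    with t have "eventually (\<lambda>s. a < \<phi> s) (nhds t)"
      by (auto simp: eventually_nhds_conv_at)
    then show "\<exists>T. open T \<and> t \<in> T \<and> T \<subseteq> {t. a < \<phi> t}"
      by (auto simp: eventually_nhds)
  qed
  then show "{x \<in> space borel. a < \<phi> x} \<in> sets borel"
    by (simp add: borel_open)
qed

lemma Phi0_convex:
  "\<phi> \<in> Phi0 \<Longrightarrow> 0 \<le> u \<Longrightarrow> 0 \<le> v \<Longrightarrow> u + v = 1 \<Longrightarrow>
    \<phi> (u * x + v * y) \<le> ennreal u * \<phi> x + ennreal v * \<phi> y"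
  unfolding Phi0_def ext_convex_def by blast

lemma Phi0_infinite_neg: "\<phi> \<in> Phi0 \<Longrightarrow> t < 0 \<Longrightarrow> \<phi> t = \<infinity>"
  by (force simp: Phi0_def eff_dom_def less_top)

text \<open>For \<open>a > 0\<close> and finite \<open>b\<close> the affine map is an order
  automorphism of the extended reals. In this adjoint form it moves suprema through the map.\<close>

lemma ereal_affine_le_iff:
  fixes x S :: ereal
  assumes "a > 0"
  shows "ereal a * x + ereal b \<le> S \<longleftrightarrow> x \<le> (S - ereal b) / ereal a"
  using assms by (cases x; cases S) (auto simp: field_simps)

lemma ereal_affine_SUP:
  fixes F :: "'i \<Rightarrow> ereal"
  assumes "a > 0"
  shows "ereal a * (SUP i. F i) + ereal b = (SUP i. ereal a * F i + ereal b)"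
proof (rule antisym)
  show "ereal a * (SUP i. F i) + ereal b \<le> (SUP i. ereal a * F i + ereal b)"
    unfolding ereal_affine_le_iff[OF assms]
  proof (rule SUP_least)
    fix i
    show "F i \<le> ((SUP i. ereal a * F i + ereal b) - ereal b) / ereal a"
      unfolding ereal_affine_le_iff[OF assms, symmetric] by (rule SUP_upper) simp
  qed
  show "(SUP i. ereal a * F i + ereal b) \<le> ereal a * (SUP i. F i) + ereal b"
    using assms by (intro SUP_least add_right_mono ereal_mult_left_mono SUP_upper) auto
qed

text \<open>
  A countable dense subset of the part of the epigraph over the positive half-line determines the
  conjugate, by continuity of \<open>(t, c) \<mapsto> s t - c\<close>; the point \<open>t = 0\<close> is a limit of such points
  along the segment to \<open>(1, 0)\<close>.
\<close>

lemma convex_conjugate_countable: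
  assumes \<phi>: "\<phi> \<in> Phi0"
  obtains t c :: "nat \<Rightarrow> real"
  where "\<And>n. t n > 0" "\<And>n. c n \<ge> 0" "\<And>n. \<phi> (t n) \<le> ennreal (c n)"
    "\<And>s. s \<noteq> -\<infinity> \<Longrightarrow> convex_conjugate \<phi> s = (SUP n. ereal (t n) * s + ereal (- c n))"
proof -
  define D where "D = {(t::real, c::real). t > 0 \<and> c \<ge> 0 \<and> \<phi> t \<le> ennreal c}"
  obtain T where T: "countable T" "T \<subseteq> D" "D \<subseteq> closure T"
    using separable[of D] by blast
  have "(1, 0) \<in> D" using \<phi> by (auto simp: D_def Phi0_def)
  then have "T \<noteq> {}" using T by auto
  define e where "e = from_nat_into T"
  have e: "range e = T" unfolding e_def using T \<open>T \<noteq> {}\<close> by simp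
  define t c where "t = fst \<circ> e" and "c = snd \<circ> e"
  have eD: "(t n, c n) \<in> D" for n using e T by (auto simp: t_def c_def)
  have pos: "t n > 0" "c n \<ge> 0" "\<phi> (t n) \<le> ennreal (c n)" for n
    using eD[of n] by (auto simp: D_def)
  have main: "convex_conjugate \<phi> s = (SUP n. ereal (t n) * s + ereal (- c n))" (is "_ = ?S")
    if "s \<noteq> -\<infinity>" for s
  proof (cases s)
    case PInf
    then have "ereal (t n) * s + ereal (- c n) = \<infinity>" for n using pos(1)[of n] by simp
    then have "?S = (SUP n::nat. \<infinity>)" by (intro SUP_cong) blast+
    then have "?S = \<infinity>" by simp
    then show ?thesis using PInf convex_conjugate_infinity[OF \<phi>] by simp
  next
    case MInf
    then show ?thesis using that by simp
  next
    case (real x)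
    show ?thesis
    proof (rule antisym)
      show "?S \<le> convex_conjugate \<phi> s"
      proof (rule SUP_least)
        fix n
        have "enn2ereal (\<phi> (t n)) \<le> ereal (c n)"
          using pos[of n] by (metis enn2ereal_ennreal less_eq_ennreal.rep_eq)
        then have "ereal (t n) * s + ereal (- c n) \<le> s * ereal (t n) - enn2ereal (\<phi> (t n))"
          using real by (cases "enn2ereal (\<phi> (t n))") (auto simp: mult.commute)
        also have "\<dots> \<le> convex_conjugate \<phi> s"
          unfolding convex_conjugate_def by (rule SUP_upper) simp
        finally show "ereal (t n) * s + ereal (- c n) \<le> convex_conjugate \<phi> s" .
      qed
    next
      show "convex_conjugate \<phi> s \<le> ?S"
      proof (cases "?S = \<infinity>")
        case False
        have "ereal (t 0) * s + ereal (- c 0) \<le> ?S" by (rule SUP_upper) simp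
        then obtain B where B: "?S = ereal B" using False real by (cases ?S) auto
        have "T \<subseteq> {p. x * fst p - snd p \<le> B}"
        proof
          fix p assume "p \<in> T"
          then obtain n where n: "p = e n" using e by auto
          have "ereal (t n) * s + ereal (- c n) \<le> ?S" by (rule SUP_upper) simp
          then show "p \<in> {p. x * fst p - snd p \<le> B}"
            unfolding B using real n by (simp add: t_def c_def mult.commute)
        qed
        moreover have cl: "closed {p::real\<times>real. x * fst p - snd p \<le> B}"
          by (intro closed_Collect_le continuous_intros)
        ultimately have "closure T \<subseteq> {p. x * fst p - snd p \<le> B}"
          by (rule closure_minimal)
        then have DB: "x * u - q \<le> B" if "(u, q) \<in> D" for u q
          using that T by auto
        have key: "x * u - enn2real (\<phi> u) \<le> B" if fin: "\<phi> u < \<infinity>" for u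
        proof -
          have "u \<ge> 0" using Phi0_infinite_neg[OF \<phi>, of u] fin by (cases "u < 0") auto
          show ?thesis
          proof (cases "u > 0")
            case True
            then show ?thesis using fin by (intro DB) (auto simp: D_def)
          next
            case False
            with \<open>u \<ge> 0\<close> have u: "u = 0" by simp
            have "eventually (\<lambda>z. x * z - (1 - z) * enn2real (\<phi> 0) \<le> B) (at_right 0)"
              unfolding eventually_at_right_field
            proof (intro exI[of _ 1] conjI allI impI)
              fix z :: real assume z: "0 < z" "z < 1"
              have "\<phi> ((1 - z) * 0 + z * 1) \<le> ennreal (1 - z) * \<phi> 0 + ennreal z * \<phi> 1"
                using \<phi> z by (intro Phi0_convex) auto
              also have "\<dots> = ennreal ((1 - z) * enn2real (\<phi> 0))"
                using \<phi> fin z unfolding u by (simp add: Phi0_def ennreal_mult)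
              finally have "\<phi> z \<le> ennreal ((1 - z) * enn2real (\<phi> 0))" by simp
              then show "x * z - (1 - z) * enn2real (\<phi> 0) \<le> B"
                using z by (intro DB) (auto simp: D_def)
            qed simp
            moreover have "((\<lambda>z. x * z - (1 - z) * enn2real (\<phi> 0)) \<longlongrightarrow>
                x * 0 - (1 - 0) * enn2real (\<phi> 0)) (at_right 0)"
              by (intro tendsto_intros)
            ultimately have "x * 0 - (1 - 0) * enn2real (\<phi> 0) \<le> B"
              by (intro tendsto_upperbound) auto
            then show ?thesis by (simp add: u)
          qed
        qed
        show ?thesis
          unfolding convex_conjugate_def B
        proof (rule SUP_least)
          fix u
          show "s * ereal u - enn2ereal (\<phi> u) \<le> ereal B"
          proof (cases "\<phi> u" rule: ennreal_cases)
            case (real q)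
            then show ?thesis using key[of u] \<open>s = ereal x\<close> by (auto simp: enn2ereal_ennreal)
          qed (use real in auto)
        qed
      qed simp
    qed
  qed
  show thesis by (rule that[of t c]) (use pos main in auto)
qed

text \<open>The factor \<open>l\<close> passes into the supremum and cancels the division by
  \<open>l\<close> in each slope term, so it survives only in the intercepts.\<close>

lemma conjugate_persp_countable:
  assumes \<phi>: "\<phi> \<in> Phi0" and "l > 0"
    and tc: "\<And>s. s \<noteq> -\<infinity> \<Longrightarrow> convex_conjugate \<phi> s = (SUP n. ereal (t n) * s + ereal (- c n))"
    and "s \<noteq> -\<infinity>"
  shows "conjugate_persp \<phi> l s = (SUP n::nat. ereal (t n) * s + ereal (- l * c n))"
proof -
  have "s / ereal l \<noteq> -\<infinity>" using assms by (cases s) auto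
  then have "conjugate_persp \<phi> l s
      = ereal l * (SUP n. ereal (t n) * (s / ereal l) + ereal (- c n)) + ereal 0"
    using assms by (simp add: conjugate_persp_def)
  also have "\<dots> = (SUP n. ereal l * (ereal (t n) * (s / ereal l) + ereal (- c n)) + ereal 0)"
    using \<open>l > 0\<close> by (rule ereal_affine_SUP)
  also have "\<dots> = (SUP n. ereal (t n) * s + ereal (- l * c n))"
  proof (rule SUP_cong)
    fix n
    show "ereal l * (ereal (t n) * (s / ereal l) + ereal (- c n)) + ereal 0
        = ereal (t n) * s + ereal (- l * c n)"
      using assms(2,4)
      by (cases s; cases "t n" "0::real" rule: linorder_cases) (auto simp: field_simps)
  qed simp
  finally show ?thesis .
qed

text \<open>The supremum in the definition runs over all reals; its countable affine form is a
  countable supremum of measurable functions.\<close>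

lemma convex_conjugate_measurable:
  assumes "\<phi> \<in> Phi0" "f \<in> borel_measurable M" "\<And>\<omega>. f \<omega> \<noteq> -\<infinity>"
  shows "(\<lambda>\<omega>. convex_conjugate \<phi> (f \<omega>)) \<in> borel_measurable M"
proof -
  obtain t c :: "nat \<Rightarrow> real" where
    "\<And>s. s \<noteq> -\<infinity> \<Longrightarrow> convex_conjugate \<phi> s = (SUP n. ereal (t n) * s + ereal (- c n))"
    using convex_conjugate_countable[OF assms(1)] by metis
  then show ?thesis using assms(2,3) by simp
qed

lemma conjugate_persp_measurable:
  assumes "\<phi> \<in> Phi0" "l \<ge> 0" and [measurable]: "f \<in> borel_measurable M" and "\<And>\<omega>. f \<omega> \<noteq> -\<infinity>"
  shows "(\<lambda>\<omega>. conjugate_persp \<phi> l (f \<omega>)) \<in> borel_measurable M"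
proof (cases "l = 0")
  case True
  then show ?thesis by (simp add: conjugate_persp_def)
next
  case False
  have "(\<lambda>\<omega>. convex_conjugate \<phi> (f \<omega> / ereal l)) \<in> borel_measurable M"
  proof (rule convex_conjugate_measurable)
    fix \<omega> show "f \<omega> / ereal l \<noteq> -\<infinity>" using False assms(2) assms(4)[of \<omega>] by (cases "f \<omega>") auto
  qed (use assms in auto)
  then show ?thesis using False by (simp add: conjugate_persp_def)
qed

lemma conjugate_persp_one: "conjugate_persp \<phi> 1 = convex_conjugate \<phi>"
  by (auto simp: conjugate_persp_def fun_eq_iff simp flip: one_ereal_def)

lemma conjugate_persp_infinity:
  assumes "\<phi> \<in> Phi0" "l \<ge> 0"
  shows "conjugate_persp \<phi> l \<infinity> = \<infinity>"
  using assms convex_conjugate_infinity[of \<phi>] by (simp add: conjugate_persp_def)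

text \<open>Fenchel's inequality at \<open>s / l\<close>, multiplied by \<open>l\<close>. For
  \<open>l = 0\<close> the convention gives the same: either \<open>s \<le> 0\<close>, and then
  \<open>s * g \<le> 0\<close>, or the right-hand side is infinite.\<close>

lemma conjugate_persp_ge:
  assumes "l \<ge> 0" "g \<ge> 0" "\<phi> g < \<infinity>"
  shows "ereal (s * g - l * enn2real (\<phi> g)) \<le> conjugate_persp \<phi> l (ereal s)"
proof (cases "l = 0")
  case True
  then show ?thesis using assms by (auto simp: conjugate_persp_def mult_nonpos_nonneg)
next
  case False
  obtain q where q: "\<phi> g = ennreal q" "q \<ge> 0" using assms(3) by (cases "\<phi> g" rule: ennreal_cases) auto
  have "ereal (s / l * g - q) = ereal (s / l) * ereal g - enn2ereal (\<phi> g)"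
    using q by (simp add: enn2ereal_ennreal)
  also have "\<dots> \<le> convex_conjugate \<phi> (ereal (s / l))"
    unfolding convex_conjugate_def by (rule SUP_upper) simp
  finally have "ereal l * ereal (s / l * g - q) \<le> ereal l * convex_conjugate \<phi> (ereal (s / l))"
    using assms by (intro ereal_mult_left_mono) auto
  moreover have "l * (s / l * g - q) = s * g - l * q" using False by (simp add: field_simps)
  ultimately show ?thesis using False q by (simp add: conjugate_persp_def)
qed

section \<open>Extended expectations and weak duality\<close>

lemma lower_minus_mono:
  assumes "a \<le> a'" "b' \<le> b"
  shows "a \<ominus>\<^sub>l b \<le> a' \<ominus>\<^sub>l b'"
  using assms by (auto simp: lower_minus_def intro: ereal_minus_mono)

lemma ext_expectation_mono:
  assumes "\<And>\<omega>. f \<omega> \<le> g \<omega>"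
  shows "ext_expectation M f \<le> ext_expectation M g"
  unfolding ext_expectation_def
  by (intro lower_minus_mono; unfold less_eq_ennreal.rep_eq[symmetric];
      intro nn_integral_mono e2ennreal_mono) (use assms in auto)

lemma ext_expectation_integrable:
  assumes "integrable M f"
  shows "ext_expectation M (\<lambda>\<omega>. ereal (f \<omega>)) = ereal (\<integral>\<omega>. f \<omega> \<partial>M)"
proof -
  have fin: "(\<integral>\<^sup>+ \<omega>. ennreal (f \<omega>) \<partial>M) < \<infinity>" "(\<integral>\<^sup>+ \<omega>. ennreal (- f \<omega>) \<partial>M) < \<infinity>"
    using integrableD(2)[OF assms] integrableD(2)[OF integrable_minus[OF assms]]
    by (auto simp: less_top)
  have e: "enn2ereal x = ereal (enn2real x)" if "x < \<infinity>" for x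
    using that by (cases x) auto
  show ?thesis
    unfolding real_lebesgue_integral_def[OF assms]
    using fin by (simp add: ext_expectation_def lower_minus_def e)
qed

text \<open>
  The inequality between positive and negative parts is the integrand form of
  \<open>\<lambda> \<phi>\<^sup>*((f + \<theta>) / \<lambda>) \<ge> (f + \<theta>) g - \<lambda> \<phi>(g)\<close>, with all terms moved so that no \<open>\<infinity> - \<infinity>\<close> occurs.
\<close>

lemma conjugate_persp_parts:
  fixes \<theta> :: real
  assumes "\<phi> \<in> Phi0" "l \<ge> 0" "g \<ge> 0" "\<phi> g < \<infinity>" "f \<noteq> -\<infinity>"
  defines "Z \<equiv> conjugate_persp \<phi> l (f + ereal \<theta>)"
  shows "ennreal g * e2ennreal f + ennreal \<theta> * ennreal g + e2ennreal (- Z)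
    \<le> e2ennreal Z + (ennreal g * e2ennreal (- f) + ennreal (- \<theta>) * ennreal g + ennreal l * \<phi> g)"
proof (cases f)
  case PInf
  then have "Z = \<infinity>" using conjugate_persp_infinity assms by (simp add: Z_def)
  then show ?thesis by simp
next
  case MInf
  then show ?thesis using assms by simp
next
  case (real x)
  obtain q where q: "\<phi> g = ennreal q" "q \<ge> 0" using assms(4) by (cases "\<phi> g" rule: ennreal_cases) auto
  have le: "ereal ((x + \<theta>) * g - l * q) \<le> Z"
    using conjugate_persp_ge[of l g \<phi> "x + \<theta>"] assms(2-4) real q by (simp add: Z_def)
  show ?thesis
  proof (cases Z)
    case (real z)
    \<comment> \<open>\<open>ennreal\<close> truncates at 0, so every positive or negative part is a
      \<open>max _ 0\<close>. This reduces the claim to an inequality between reals.\<close>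
    have m: "ennreal a = ennreal (max a 0)" for a by (simp add: ennreal_neg max_def)
    have "max x 0 - max (-x) 0 = x" "max \<theta> 0 - max (-\<theta>) 0 = \<theta>" "max z 0 - max (-z) 0 = z"
      by (auto simp: max_def)
    then have id: "g * max x 0 = g * x + g * max (-x) 0" "max \<theta> 0 * g = \<theta> * g + max (-\<theta>) 0 * g"
      "max z 0 - max (-z) 0 = z"
      by (metis distrib_left diff_add_cancel add.commute, metis distrib_right diff_add_cancel add.commute, simp)
    have "g * max x 0 + max \<theta> 0 * g + max (-z) 0
        \<le> max z 0 + (g * max (-x) 0 + max (-\<theta>) 0 * g + l * q)"
      using le id real by (simp add: algebra_simps)
    then have "ennreal (g * max x 0 + max \<theta> 0 * g + max (-z) 0)
        \<le> ennreal (max z 0 + (g * max (-x) 0 + max (-\<theta>) 0 * g + l * q))"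
      by (rule ennreal_leI)
    then have "ennreal g * ennreal (max x 0) + ennreal (max \<theta> 0) * ennreal g + ennreal (max (-z) 0)
        \<le> ennreal (max z 0) + (ennreal g * ennreal (max (-x) 0) + ennreal (max (-\<theta>) 0) * ennreal g
          + ennreal l * ennreal q)"
      using assms(2,3) q by (simp add: ennreal_mult ennreal_plus)
    then show ?thesis
      unfolding m[symmetric] using real \<open>f = ereal x\<close> q by simp
  qed (use le in auto)
qed

text \<open>Fenchel's inequality is integrated against the density \<open>g\<close> of
  \<open>Q'\<close> with respect to \<open>Q\<close>: the shift \<open>\<theta>\<close> comes out
  unchanged because \<open>g\<close> integrates to 1, and the divergence contributes
  \<open>l * i\<close>. Positive and negative parts are kept apart in \<open>ennreal\<close>, since
  \<open>f\<close> need not be integrable.\<close>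

lemma fenchel_divergence_bound:
  assumes "prob_space Q" "prob_space Q'" and sets: "sets Q' = sets Q"
    and ac: "absolutely_continuous Q Q'"
    and \<phi>: "\<phi> \<in> Phi0" "lower_semicont \<phi>" and l: "l \<ge> 0"
    and f[measurable]: "f \<in> borel_measurable Q" and nm: "\<And>\<omega>. f \<omega> \<noteq> -\<infinity>"
    and I: "phi_divergence \<phi> Q' Q = ennreal i" "i \<ge> 0"
  shows "ext_expectation Q' f + ereal \<theta>
    \<le> ereal (l * i) + ext_expectation Q (\<lambda>\<omega>. conjugate_persp \<phi> l (f \<omega> + ereal \<theta>))"
proof -
  interpret Q: prob_space Q by fact
  interpret Q': prob_space Q' by fact
  have [measurable]: "\<phi> \<in> borel_measurable borel" by (rule lower_semicont_measurable) fact
  define g where "g \<omega> = enn2real (RN_deriv Q Q' \<omega>)" for \<omega>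
  have [measurable]: "g \<in> borel_measurable Q" by (simp add: g_def[abs_def])
  have g0: "g \<omega> \<ge> 0" for \<omega> by (simp add: g_def)
  have "AE \<omega> in Q. RN_deriv Q Q' \<omega> \<noteq> \<infinity>"
    by (rule Q.RN_deriv_finite[OF Q'.sigma_finite_measure_axioms ac sets])
  then have "AE \<omega> in Q. RN_deriv Q Q' \<omega> = ennreal (g \<omega>)"
    by eventually_elim (simp add: g_def less_top)
  then have Q'_eq: "Q' = density Q (\<lambda>\<omega>. ennreal (g \<omega>))"
    using Q.density_RN_deriv[OF ac sets] density_cong[of "RN_deriv Q Q'" Q "\<lambda>\<omega>. ennreal (g \<omega>)"] by simp
  have int: "(\<integral>\<^sup>+ \<omega>. h \<omega> \<partial>Q') = (\<integral>\<^sup>+ \<omega>. ennreal (g \<omega>) * h \<omega> \<partial>Q)" if "h \<in> borel_measurable Q" for h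
    using that by (subst Q'_eq) (simp add: nn_integral_density)
  have g1: "(\<integral>\<^sup>+ \<omega>. ennreal (g \<omega>) \<partial>Q) = 1"
    using int[of "\<lambda>_. 1"] Q'.emeasure_space_1 by simp
  have I_eq: "(\<integral>\<^sup>+ \<omega>. \<phi> (g \<omega>) \<partial>Q) = ennreal i"
    using I ac by (simp add: phi_divergence_def g_def)
  then have fin: "AE \<omega> in Q. \<phi> (g \<omega>) < \<infinity>"
    using nn_integral_PInf_AE[of "\<lambda>\<omega>. \<phi> (g \<omega>)" Q] by (simp add: less_top)
  define Z where "Z \<omega> = conjugate_persp \<phi> l (f \<omega> + ereal \<theta>)" for \<omega>
  have [measurable]: "Z \<in> borel_measurable Q"
    unfolding Z_def using nm by (intro conjugate_persp_measurable \<phi> l) auto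
  define F G A B where "F = (\<integral>\<^sup>+ \<omega>. e2ennreal (f \<omega>) \<partial>Q')" and "G = (\<integral>\<^sup>+ \<omega>. e2ennreal (- f \<omega>) \<partial>Q')"
    and "A = (\<integral>\<^sup>+ \<omega>. e2ennreal (Z \<omega>) \<partial>Q)" and "B = (\<integral>\<^sup>+ \<omega>. e2ennreal (- Z \<omega>) \<partial>Q)"
  have parts: "AE \<omega> in Q. ennreal (g \<omega>) * e2ennreal (f \<omega>) + ennreal \<theta> * ennreal (g \<omega>) + e2ennreal (- Z \<omega>)
    \<le> e2ennreal (Z \<omega>) + (ennreal (g \<omega>) * e2ennreal (- f \<omega>) + ennreal (- \<theta>) * ennreal (g \<omega>) + ennreal l * \<phi> (g \<omega>))"
    using fin by eventually_elim (auto simp: Z_def intro!: conjugate_persp_parts \<phi> l g0 nm)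
  have "(\<integral>\<^sup>+ \<omega>. ennreal (g \<omega>) * e2ennreal (f \<omega>) + ennreal \<theta> * ennreal (g \<omega>) + e2ennreal (- Z \<omega>) \<partial>Q)
    \<le> (\<integral>\<^sup>+ \<omega>. e2ennreal (Z \<omega>) + (ennreal (g \<omega>) * e2ennreal (- f \<omega>) + ennreal (- \<theta>) * ennreal (g \<omega>) + ennreal l * \<phi> (g \<omega>)) \<partial>Q)"
    using parts by (rule nn_integral_mono_AE)
  then have main: "F + ennreal \<theta> + B \<le> A + (G + ennreal (- \<theta>) + ennreal l * ennreal i)"
    by (simp add: nn_integral_add nn_integral_cmult g1 I_eq int F_def G_def A_def B_def)
  \<comment> \<open>Where \<open>Z\<close> is nonpositive its positive part drops out of the
    previous estimate; elsewhere its negative part is 0. Hence \<open>B\<close> is finite whenever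
    \<open>G\<close> is, and the expectation of \<open>Z\<close> does not fall under the convention
    for \<infinity> - \<infinity>.\<close>
  have "AE \<omega> in Q. e2ennreal (- Z \<omega>)
    \<le> ennreal (g \<omega>) * e2ennreal (- f \<omega>) + ennreal (- \<theta>) * ennreal (g \<omega>) + ennreal l * \<phi> (g \<omega>)"
    using parts
  proof eventually_elim
    case (elim \<omega>)
    show ?case
    proof (cases "Z \<omega> \<le> 0")
      case True
      then have "e2ennreal (Z \<omega>) = 0" by (simp add: e2ennreal_neg)
      then show ?thesis using elim by (auto intro: order_trans[rotated])
    next
      case False
      then show ?thesis by (simp add: e2ennreal_neg)
    qed
  qed
  then have "B \<le> (\<integral>\<^sup>+ \<omega>. ennreal (g \<omega>) * e2ennreal (- f \<omega>) + ennreal (- \<theta>) * ennreal (g \<omega>) + ennreal l * \<phi> (g \<omega>) \<partial>Q)"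
    unfolding B_def by (rule nn_integral_mono_AE)
  then have B_le: "B \<le> G + ennreal (- \<theta>) + ennreal l * ennreal i"
    by (simp add: nn_integral_add nn_integral_cmult g1 I_eq int G_def)
  show ?thesis
  proof (cases "G = \<infinity>")
    case True
    then have "ext_expectation Q' f = -\<infinity>" by (simp add: ext_expectation_def lower_minus_def G_def)
    then show ?thesis by simp
  next
    case False
    then obtain \<gamma> where \<gamma>: "G = ennreal \<gamma>" "\<gamma> \<ge> 0" by (cases G rule: ennreal_cases) auto
    have "B < \<infinity>" using B_le \<gamma> by (simp add: le_less_trans ennreal_mult_less_top)
    then obtain \<beta> where \<beta>: "B = ennreal \<beta>" "\<beta> \<ge> 0" by (cases B rule: ennreal_cases) auto
    have eQ': "ext_expectation Q' f = enn2ereal F - ereal \<gamma>"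
      using \<gamma> by (simp add: ext_expectation_def lower_minus_def F_def[symmetric] G_def[symmetric] enn2ereal_ennreal)
    have eQ: "ext_expectation Q Z = enn2ereal A - ereal \<beta>"
      using \<beta> by (simp add: ext_expectation_def lower_minus_def A_def[symmetric] B_def[symmetric] enn2ereal_ennreal)
    have "enn2ereal F - ereal \<gamma> + ereal \<theta> \<le> ereal (l * i) + (enn2ereal A - ereal \<beta>)"
    proof (cases A rule: ennreal_cases)
      case (real a)
      have "F \<le> F + ennreal \<theta> + B" by (simp add: add.assoc)
      also note main
      also have "A + (G + ennreal (- \<theta>) + ennreal l * ennreal i) < \<infinity>"
        using real \<gamma> by (simp add: ennreal_mult_less_top)
      finally have "F < \<infinity>" .
      then obtain b where b: "F = ennreal b" "b \<ge> 0" by (cases F rule: ennreal_cases) auto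
      have "ennreal (b + max \<theta> 0 + \<beta>) \<le> ennreal (a + (\<gamma> + max (-\<theta>) 0 + l * i))"
        using main real \<gamma> \<beta> b I l by (simp add: ennreal_plus ennreal_mult)
      then have "b + max \<theta> 0 + \<beta> \<le> a + (\<gamma> + max (-\<theta>) 0 + l * i)"
        using real \<gamma> l I by (subst (asm) ennreal_le_iff) auto
      then show ?thesis using b real by (auto simp: enn2ereal_ennreal max_def split: if_splits)
    qed simp
    then show ?thesis using eQ' eQ by (simp add: Z_def[abs_def])
  qed
qed

text \<open>The Fenchel bound is chained from the innermost measure outwards: from \<open>Q'\<close>
  to \<open>Q\<close> with \<open>\<theta>3\<close>, from \<open>Q\<close> to \<open>P\<close> with
  \<open>\<theta>2\<close>, both with factor 1, and from \<open>P\<close> to \<open>P0\<close> with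
  \<open>\<theta>1\<close> and factor \<open>l\<close>. The conjugate produced at each stage is the
  integrand of the next.\<close>

lemma globalized_robust_oce_le:
  fixes l \<theta>1 \<theta>2 \<theta>3 :: real
  assumes "prob_space P0" and X[measurable]: "X \<in> borel_measurable P0"
    and \<phi>: "\<phi>1 \<in> Phi0" "\<phi>2 \<in> Phi0" "\<phi>3 \<in> Phi0"
    and lsc: "lower_semicont \<phi>1" "lower_semicont \<phi>2" "lower_semicont \<phi>3"
    and r: "r \<ge> 0" and l: "l \<ge> 0"
  shows "globalized_robust_oce \<phi>1 \<phi>2 \<phi>3 r P0 X \<le> ereal (- \<theta>1 - \<theta>2 - \<theta>3 + l * r)
       + ext_expectation P0 (\<lambda>\<omega>. conjugate_persp \<phi>3 l
           (convex_conjugate \<phi>2 (convex_conjugate \<phi>1 (ereal (\<theta>3 - X \<omega>)) + ereal \<theta>2) + ereal \<theta>1))"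
    (is "_ \<le> _ + ?E0")
  unfolding globalized_robust_oce_def
proof (intro SUP_least, clarify)
  fix P Q Q'
  assume P: "P \<in> prob_measures_on P0" "phi_divergence \<phi>3 P P0 \<le> ennreal r"
    and Q: "Q \<in> prob_measures_on P0" "absolutely_continuous P Q"
    and Q': "Q' \<in> prob_measures_on P0" "absolutely_continuous Q Q'"
  have sets: "sets P = sets P0" "sets Q = sets P0" "sets Q' = sets P0"
    and prob: "prob_space P" "prob_space Q" "prob_space Q'"
    using P Q Q' by (auto simp: prob_measures_on_def)
  note m = measurable_cong_sets[OF sets(1) refl, of borel] measurable_cong_sets[OF sets(2) refl, of borel]
  define f1 where "f1 \<omega> = convex_conjugate \<phi>1 (ereal (- X \<omega>) + ereal \<theta>3)" for \<omega>
  define f2 where "f2 \<omega> = convex_conjugate \<phi>2 (f1 \<omega> + ereal \<theta>2)" for \<omega>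
  have f1_nm: "f1 \<omega> \<noteq> -\<infinity>" for \<omega>
    using convex_conjugate_ge[OF \<phi>(1), of "ereal (- X \<omega>) + ereal \<theta>3"] by (auto simp: f1_def)
  have f2_nm: "f2 \<omega> \<noteq> -\<infinity>" for \<omega>
    using convex_conjugate_ge[OF \<phi>(2), of "f1 \<omega> + ereal \<theta>2"] f1_nm[of \<omega>] by (auto simp: f2_def)
  have [measurable]: "f1 \<in> borel_measurable P0"
    unfolding f1_def by (intro convex_conjugate_measurable \<phi>) auto
  have [measurable]: "f2 \<in> borel_measurable P0"
    unfolding f2_def by (intro convex_conjugate_measurable \<phi>) (use f1_nm in auto)
  let ?J = "ext_expectation Q' (\<lambda>\<omega>. ereal (- X \<omega>))"
  show "?J \<ominus>\<^sub>l enn2ereal (phi_divergence \<phi>1 Q' Q) \<ominus>\<^sub>l enn2ereal (phi_divergence \<phi>2 Q P)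
      \<le> ereal (- \<theta>1 - \<theta>2 - \<theta>3 + l * r) + ?E0"
  proof (cases "phi_divergence \<phi>1 Q' Q = \<infinity> \<or> phi_divergence \<phi>2 Q P = \<infinity>")
    \<comment> \<open>An infinite penalty makes the objective -\<infinity>.\<close>
    case True
    then show ?thesis
      by (cases "enn2ereal (phi_divergence \<phi>2 Q P)") (auto simp: lower_minus_def)
  next
    case False
    obtain i1 where i1: "phi_divergence \<phi>1 Q' Q = ennreal i1" "i1 \<ge> 0"
      using False by (cases "phi_divergence \<phi>1 Q' Q" rule: ennreal_cases) auto
    obtain i2 where i2: "phi_divergence \<phi>2 Q P = ennreal i2" "i2 \<ge> 0"
      using False by (cases "phi_divergence \<phi>2 Q P" rule: ennreal_cases) auto
    obtain i3 where i3: "phi_divergence \<phi>3 P P0 = ennreal i3" "i3 \<ge> 0"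
      using P by (cases "phi_divergence \<phi>3 P P0" rule: ennreal_cases) (auto simp: top_unique)
    have "i3 \<le> r" using P i3 r by simp
    then have lr: "l * i3 \<le> l * r" using l by (rule mult_left_mono)
    have ac: "absolutely_continuous P0 P"
      using i3 by (auto simp: phi_divergence_def split: if_splits)
    have "?J + ereal \<theta>3 \<le> ereal (1 * i1) + ext_expectation Q (\<lambda>\<omega>. conjugate_persp \<phi>1 1 (ereal (- X \<omega>) + ereal \<theta>3))"
      by (rule fenchel_divergence_bound[OF prob(2,3) _ Q'(2) \<phi>(1) lsc(1) _ _ _ i1]) (auto simp: sets m)
    then have s1: "?J + ereal \<theta>3 \<le> ereal i1 + ext_expectation Q f1"
      by (simp add: conjugate_persp_one f1_def[abs_def])
    have "ext_expectation Q f1 + ereal \<theta>2 \<le> ereal (1 * i2) + ext_expectation P (\<lambda>\<omega>. conjugate_persp \<phi>2 1 (f1 \<omega> + ereal \<theta>2))"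
      by (rule fenchel_divergence_bound[OF prob(1,2) _ Q(2) \<phi>(2) lsc(2) _ _ _ i2]) (auto simp: sets m f1_nm)
    then have s2: "ext_expectation Q f1 + ereal \<theta>2 \<le> ereal i2 + ext_expectation P f2"
      by (simp add: conjugate_persp_one f2_def[abs_def])
    have "ext_expectation P f2 + ereal \<theta>1 \<le> ereal (l * i3) + ext_expectation P0 (\<lambda>\<omega>. conjugate_persp \<phi>3 l (f2 \<omega> + ereal \<theta>1))"
      by (rule fenchel_divergence_bound[OF assms(1) prob(1) _ ac \<phi>(3) lsc(3) l _ _ i3]) (auto simp: sets f2_nm)
    then have s3: "ext_expectation P f2 + ereal \<theta>1 \<le> ereal (l * i3) + ?E0"
      by (simp add: f2_def f1_def add.commute)
    have "?J \<ominus>\<^sub>l enn2ereal (phi_divergence \<phi>1 Q' Q) \<ominus>\<^sub>l enn2ereal (phi_divergence \<phi>2 Q P)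
        = ?J - ereal i1 - ereal i2"
      using i1 i2 by (simp add: lower_minus_def enn2ereal_ennreal)
    also have "\<dots> \<le> ereal (- \<theta>1 - \<theta>2 - \<theta>3 + l * r) + ?E0"
      using s1 s2 s3 lr
      by (cases ?J; cases "ext_expectation Q f1"; cases "ext_expectation P f2"; cases ?E0) auto
    finally show ?thesis .
  qed
qed

section \<open>Interchange of supremum and expectation\<close>

text \<open>The least index of a maximum among \<open>A 0 \<omega>\<close>, ...,
  \<open>A n \<omega>\<close>, since the index moves only on strict improvement. The recursion makes
  measurability in \<open>\<omega>\<close> immediate.\<close>

fun running_argmax :: "(nat \<Rightarrow> 'a \<Rightarrow> real) \<Rightarrow> nat \<Rightarrow> 'a \<Rightarrow> nat" where
  "running_argmax A 0 \<omega> = 0"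
| "running_argmax A (Suc n) \<omega> =
    (if A (running_argmax A n \<omega>) \<omega> < A (Suc n) \<omega> then Suc n else running_argmax A n \<omega>)"

lemma running_argmax_le: "running_argmax A n \<omega> \<le> n"
  by (induction n) (auto simp: le_Suc_eq)

lemma running_argmax_ge: "A n \<omega> \<le> A (running_argmax A n \<omega>) \<omega>"
  by (cases n) auto

lemma running_argmax_incseq: "incseq (\<lambda>n. A (running_argmax A n \<omega>) \<omega>)"
  by (rule incseq_SucI) auto

lemma running_argmax_measurable:
  assumes [measurable]: "\<And>n. A n \<in> borel_measurable M"
  shows "running_argmax A n \<in> measurable M (count_space UNIV)"
proof (induction n)
  case 0
  show ?case by (simp add: running_argmax.simps(1)[abs_def])
next
  case (Suc n)
  note Suc[measurable]
  show ?case unfolding running_argmax.simps(2)[abs_def] by measurable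
qed

text \<open>The running maxima are values at finitely valued measurable selections, so their
  integrals are at most \<open>C\<close>, and they increase to the supremum. Subtracting the
  integrable \<open>a 0\<close> makes them nonnegative, and monotone convergence carries the bound
  over.\<close>

lemma ext_expectation_SUP_le:
  fixes A :: "nat \<Rightarrow> 'a \<Rightarrow> real"
  assumes selint: "\<And>\<nu> N. \<nu> \<in> measurable M (count_space UNIV) \<Longrightarrow> (\<And>\<omega>. \<nu> \<omega> \<le> (N::nat)) \<Longrightarrow>
      integrable M (\<lambda>\<omega>. A (\<nu> \<omega>) \<omega>)"
    and selle: "\<And>\<nu> N. \<nu> \<in> measurable M (count_space UNIV) \<Longrightarrow> (\<And>\<omega>. \<nu> \<omega> \<le> (N::nat)) \<Longrightarrow>
      (\<integral>\<omega>. A (\<nu> \<omega>) \<omega> \<partial>M) \<le> C"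
  shows "ext_expectation M (\<lambda>\<omega>. SUP n. ereal (A n \<omega>)) \<le> ereal C"
proof -
  have Am[measurable]: "A n \<in> borel_measurable M" for n
    using selint[of "\<lambda>_. n" n] by (simp add: borel_measurable_integrable)
  define a where "a n \<omega> = A (running_argmax A n \<omega>) \<omega>" for n \<omega>
  have aint: "integrable M (a n)" and ale: "(\<integral>\<omega>. a n \<omega> \<partial>M) \<le> C" for n
    unfolding a_def
    using selint[OF running_argmax_measurable[of A M n] running_argmax_le]
      selle[OF running_argmax_measurable[of A M n] running_argmax_le] Am by auto
  have [measurable]: "a n \<in> borel_measurable M" for n using aint by (rule borel_measurable_integrable)
  have inc: "incseq (\<lambda>n. a n \<omega>)" for \<omega> unfolding a_def by (rule running_argmax_incseq)
  define B where "B \<omega> = (SUP n. ereal (A n \<omega>))" for \<omega>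
  have [measurable]: "B \<in> borel_measurable M" unfolding B_def by simp
  have aB: "ereal (a n \<omega>) \<le> B \<omega>" for n \<omega>
    unfolding B_def a_def by (rule SUP_upper) simp
  have B_eq: "B \<omega> = (SUP n. ereal (a n \<omega>))" for \<omega>
  proof (rule antisym)
    show "B \<omega> \<le> (SUP n. ereal (a n \<omega>))"
      unfolding B_def a_def by (rule SUP_mono) (use running_argmax_ge[of A _ \<omega>] in auto)
    show "(SUP n. ereal (a n \<omega>)) \<le> B \<omega>" by (rule SUP_least) (rule aB)
  qed
  have diff: "e2ennreal (B \<omega> - ereal (a 0 \<omega>)) \<le> (SUP n. ennreal (a n \<omega> - a 0 \<omega>))" for \<omega>
  proof -
    have "B \<omega> - ereal (a 0 \<omega>) = (SUP n. ereal 1 * ereal (a n \<omega>) + ereal (- a 0 \<omega>))"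
      unfolding B_eq by (subst ereal_affine_SUP[symmetric]) (auto simp: minus_ereal_def simp flip: one_ereal_def)
    also have "\<dots> \<le> enn2ereal (SUP n. ennreal (a n \<omega> - a 0 \<omega>))"
    proof (rule SUP_least)
      fix n
      have "a 0 \<omega> \<le> a n \<omega>" using inc[of \<omega>] by (simp add: incseq_def)
      then have "ereal 1 * ereal (a n \<omega>) + ereal (- a 0 \<omega>) = enn2ereal (ennreal (a n \<omega> - a 0 \<omega>))"
        by (simp add: enn2ereal_ennreal)
      also have "\<dots> \<le> enn2ereal (SUP n. ennreal (a n \<omega> - a 0 \<omega>))"
        unfolding less_eq_ennreal.rep_eq[symmetric] by (rule SUP_upper) simp
      finally show "ereal 1 * ereal (a n \<omega>) + ereal (- a 0 \<omega>) \<le> enn2ereal (SUP n. ennreal (a n \<omega> - a 0 \<omega>))" .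
    qed
    finally show ?thesis by (metis e2ennreal_enn2ereal e2ennreal_mono)
  qed
  define D where "D = C - (\<integral>\<omega>. a 0 \<omega> \<partial>M)"
  have D0: "D \<ge> 0" using ale[of 0] by (simp add: D_def)
  have "(\<integral>\<^sup>+ \<omega>. e2ennreal (B \<omega> - ereal (a 0 \<omega>)) \<partial>M) \<le> (\<integral>\<^sup>+ \<omega>. (SUP n. ennreal (a n \<omega> - a 0 \<omega>)) \<partial>M)"
    by (intro nn_integral_mono diff)
  also have "\<dots> = (SUP n. \<integral>\<^sup>+ \<omega>. ennreal (a n \<omega> - a 0 \<omega>) \<partial>M)"
    by (rule nn_integral_monotone_convergence_SUP)
      (use inc in \<open>auto simp: incseq_def le_fun_def intro!: ennreal_leI\<close>)
  also have "\<dots> \<le> ennreal D"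
  proof (rule SUP_least)
    fix n
    have "(\<integral>\<^sup>+ \<omega>. ennreal (a n \<omega> - a 0 \<omega>) \<partial>M) = ennreal (\<integral>\<omega>. a n \<omega> - a 0 \<omega> \<partial>M)"
      using inc by (intro nn_integral_eq_integral Bochner_Integration.integrable_diff aint)
        (auto simp: incseq_def)
    also have "\<dots> \<le> ennreal D"
      using ale[of n] by (intro ennreal_leI) (simp add: D_def aint)
    finally show "(\<integral>\<^sup>+ \<omega>. ennreal (a n \<omega> - a 0 \<omega>) \<partial>M) \<le> ennreal D" .
  qed
  finally have intD: "(\<integral>\<^sup>+ \<omega>. e2ennreal (B \<omega> - ereal (a 0 \<omega>)) \<partial>M) \<le> ennreal D" .
  \<comment> \<open>The decomposition of \<open>B\<close> into \<open>B - a 0\<close> and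
    \<open>a 0\<close>, with negative parts moved across so that nothing is subtracted in
    \<open>ennreal\<close>.\<close>
  have parts: "e2ennreal (B \<omega>) + ennreal (- a 0 \<omega>)
      \<le> e2ennreal (B \<omega> - ereal (a 0 \<omega>)) + ennreal (a 0 \<omega>) + e2ennreal (- B \<omega>)" for \<omega>
  proof (cases "B \<omega>")
    case (real b)
    have "a 0 \<omega> \<le> b" using aB[of 0 \<omega>] real by simp
    then have "ennreal (max b 0 + max (- a 0 \<omega>) 0) \<le> ennreal ((b - a 0 \<omega>) + max (a 0 \<omega>) 0 + max (-b) 0)"
      by (intro ennreal_leI) (auto simp: max_def)
    then show ?thesis
      using real \<open>a 0 \<omega> \<le> b\<close> by (simp add: ennreal_plus)
  next
    case MInf
    then show ?thesis using aB[of 0 \<omega>] by simp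
  qed simp
  define p q where "p = (\<integral>\<^sup>+ \<omega>. ennreal (a 0 \<omega>) \<partial>M)" and "q = (\<integral>\<^sup>+ \<omega>. ennreal (- a 0 \<omega>) \<partial>M)"
  define S T where "S = (\<integral>\<^sup>+ \<omega>. e2ennreal (B \<omega>) \<partial>M)" and "T = (\<integral>\<^sup>+ \<omega>. e2ennreal (- B \<omega>) \<partial>M)"
  have pq: "p \<noteq> \<infinity>" "q \<noteq> \<infinity>"
    unfolding p_def q_def using integrableD(2)[OF aint] integrableD(2)[OF integrable_minus[OF aint]] by auto
  have pq_int: "(\<integral>\<omega>. a 0 \<omega> \<partial>M) = enn2real p - enn2real q"
    unfolding p_def q_def by (rule real_lebesgue_integral_def[OF aint])
  \<comment> \<open>\<open>a 0\<close> is an integrable minorant of \<open>B\<close>, so the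
    negative part of \<open>B\<close> has a finite integral and the extended expectation of
    \<open>B\<close> is a genuine difference.\<close>
  have "T \<le> q"
    unfolding T_def q_def
  proof (rule nn_integral_mono)
    fix \<omega>
    have "e2ennreal (- B \<omega>) \<le> e2ennreal (ereal (- a 0 \<omega>))"
      using aB[of 0 \<omega>] by (intro e2ennreal_mono) (simp flip: uminus_ereal.simps(1))
    then show "e2ennreal (- B \<omega>) \<le> ennreal (- a 0 \<omega>)" by simp
  qed
  have "(\<integral>\<^sup>+ \<omega>. e2ennreal (B \<omega>) + ennreal (- a 0 \<omega>) \<partial>M)
      \<le> (\<integral>\<^sup>+ \<omega>. e2ennreal (B \<omega> - ereal (a 0 \<omega>)) + ennreal (a 0 \<omega>) + e2ennreal (- B \<omega>) \<partial>M)"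
    by (intro nn_integral_mono parts)
  then have "S + q \<le> (\<integral>\<^sup>+ \<omega>. e2ennreal (B \<omega> - ereal (a 0 \<omega>)) \<partial>M) + p + T"
    by (simp add: nn_integral_add S_def q_def p_def T_def)
  also have "\<dots> \<le> ennreal D + p + T" by (intro add_right_mono intD)
  finally have main: "S + q \<le> ennreal D + p + T" .
  obtain p' where p': "p = ennreal p'" "p' \<ge> 0" using pq by (cases p rule: ennreal_cases) auto
  obtain q' where q': "q = ennreal q'" "q' \<ge> 0" using pq by (cases q rule: ennreal_cases) auto
  obtain T' where T': "T = ennreal T'" "T' \<ge> 0"
    using \<open>T \<le> q\<close> pq by (cases T rule: ennreal_cases) (auto simp: top_unique)
  have "S \<le> S + q" by simp
  also note main
  also have "ennreal D + p + T < \<infinity>" using p' T' by simp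
  finally obtain S' where S': "S = ennreal S'" "S' \<ge> 0" by (cases S rule: ennreal_cases) auto
  have "ennreal (S' + q') \<le> ennreal (D + p' + T')"
    using main S' q' p' T' D0 by (simp add: ennreal_plus)
  then have "S' + q' \<le> D + p' + T'" using D0 p' T' by (subst (asm) ennreal_le_iff) auto
  then have "S' - T' \<le> C" using pq_int p' q' by (simp add: D_def)
  then have "ext_expectation M B \<le> ereal C"
    using S' T' by (simp add: ext_expectation_def lower_minus_def S_def[symmetric] T_def[symmetric] enn2ereal_ennreal)
  then show ?thesis by (simp add: B_def[abs_def])
qed

section \<open>Perspectives, admissible tuples and the measures they define\<close>

text \<open>Convexity of the perspective b \<phi>(a / b), in epigraph form. The quotient of the
  combined arguments is a convex combination of \<open>a / b\<close> and \<open>a' / b'\<close> with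
  weights proportional to \<open>u * b\<close> and \<open>v * b'\<close>, so convexity of
  \<open>\<phi>\<close> applies.\<close>

lemma Phi0_perspective_convex:
  assumes \<phi>: "\<phi> \<in> Phi0" and uv: "0 \<le> u" "0 \<le> v" "u + v = 1"
    and pos: "0 < b" "0 < b'" "0 \<le> k" "0 \<le> k'"
    and le: "\<phi> (a / b) \<le> ennreal (k / b)" "\<phi> (a' / b') \<le> ennreal (k' / b')"
  shows "\<phi> ((u * a + v * a') / (u * b + v * b')) \<le> ennreal ((u * k + v * k') / (u * b + v * b'))"
proof -
  let ?w = "u * b + v * b'"
  have w: "?w > 0"
  proof (cases "u = 0")
    case True
    then show ?thesis using uv pos by simp
  next
    case False
    then show ?thesis using uv pos by (intro add_pos_nonneg) auto
  qed
  have "(u * a + v * a') / ?w = u * b / ?w * (a / b) + v * b' / ?w * (a' / b')"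
    using pos w by (simp add: add_divide_distrib)
  also have "\<phi> \<dots> \<le> ennreal (u * b / ?w) * \<phi> (a / b) + ennreal (v * b' / ?w) * \<phi> (a' / b')"
  proof (rule Phi0_convex[OF \<phi>])
    show "u * b / ?w + v * b' / ?w = 1" using w by (simp flip: add_divide_distrib)
  qed (use uv pos w in auto)
  also have "\<dots> \<le> ennreal (u * b / ?w) * ennreal (k / b) + ennreal (v * b' / ?w) * ennreal (k' / b')"
    by (intro add_mono mult_left_mono le) auto
  also have "\<dots> = ennreal (u * b / ?w * (k / b) + v * b' / ?w * (k' / b'))"
    using uv pos w by (simp flip: ennreal_plus ennreal_mult)
  also have "u * b / ?w * (k / b) + v * b' / ?w * (k' / b') = (u * k + v * k') / ?w"
    using pos w by (simp add: add_divide_distrib)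
  finally show ?thesis .
qed

text \<open>Bounded densities keep products with \<open>X\<close> integrable when \<open>X\<close>
  is only in L1. The bound is required at every point, in line with the pointwise conditions on
  admissible tuples.\<close>

definition bounded_rv :: "'a measure \<Rightarrow> ('a \<Rightarrow> real) \<Rightarrow> bool" where
  "bounded_rv M f \<longleftrightarrow> f \<in> borel_measurable M \<and> bounded (range f)"

lemma bounded_rv_measurable[measurable_dest]: "bounded_rv M f \<Longrightarrow> f \<in> borel_measurable M"
  by (simp add: bounded_rv_def)

lemma bounded_rv_const[simp]: "bounded_rv M (\<lambda>_. c)"
  by (simp add: bounded_rv_def)

lemma bounded_rv_lincomb:
  assumes "bounded_rv M f" "bounded_rv M g"
  shows "bounded_rv M (\<lambda>\<omega>. u * f \<omega> + v * g \<omega>)"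
proof -
  obtain a b where ab: "\<And>\<omega>. \<bar>f \<omega>\<bar> \<le> a" "\<And>\<omega>. \<bar>g \<omega>\<bar> \<le> b"
    using assms by (auto simp: bounded_rv_def bounded_iff)
  have "\<bar>u * f \<omega> + v * g \<omega>\<bar> \<le> \<bar>u\<bar> * a + \<bar>v\<bar> * b" for \<omega>
    by (rule order_trans[OF abs_triangle_ineq])
      (auto simp: abs_mult intro!: add_mono mult_left_mono ab)
  then show ?thesis using assms by (auto simp: bounded_rv_def bounded_iff)
qed

lemma bounded_rv_integrable_mult:
  assumes f: "bounded_rv M f" and g: "integrable M g"
  shows "integrable M (\<lambda>\<omega>. f \<omega> * g \<omega> :: real)"
proof -
  obtain a where a: "\<And>\<omega>. \<bar>f \<omega>\<bar> \<le> a" using f by (auto simp: bounded_rv_def bounded_iff)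
  have [measurable]: "f \<in> borel_measurable M" "g \<in> borel_measurable M"
    using f g by (auto simp: bounded_rv_def)
  show ?thesis
    by (rule Bochner_Integration.integrable_bound[OF integrable_mult_right[OF g, of a]])
      (auto simp: abs_mult intro!: mult_right_mono order_trans[OF a])
qed

lemma (in finite_measure) bounded_rv_integrable: "bounded_rv M f \<Longrightarrow> integrable M f"
  using bounded_rv_integrable_mult[of M f "\<lambda>_. 1"] by simp

text \<open>
  In an admissible tuple \<open>y1, y2, y3\<close> are (not yet normalised) densities of \<open>Q', Q, P\<close> with respect
  to \<open>P0\<close>, and \<open>k1, k2, k3\<close> dominate the three divergence integrands \<open>y2 \<phi>1(y1 / y2)\<close>,
  \<open>y3 \<phi>2(y2 / y3)\<close> and \<open>\<phi>3(y3)\<close>. Replacing the integrands by upper bounds makes the set of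
  admissible tuples convex and the objective and the constraints linear.
\<close>

definition admissible ::
  "(real \<Rightarrow> ennreal) \<Rightarrow> (real \<Rightarrow> ennreal) \<Rightarrow> (real \<Rightarrow> ennreal) \<Rightarrow> 'a measure \<Rightarrow>
    ('a \<Rightarrow> real) \<Rightarrow> ('a \<Rightarrow> real) \<Rightarrow> ('a \<Rightarrow> real) \<Rightarrow>
    ('a \<Rightarrow> real) \<Rightarrow> ('a \<Rightarrow> real) \<Rightarrow> ('a \<Rightarrow> real) \<Rightarrow> bool"
where
  "admissible \<phi>1 \<phi>2 \<phi>3 M y1 y2 y3 k1 k2 k3 \<longleftrightarrow>
     (\<forall>f \<in> {y1, y2, y3, k1, k2, k3}. bounded_rv M f) \<and>
     (\<forall>\<omega>. y1 \<omega> > 0 \<and> y2 \<omega> > 0 \<and> y3 \<omega> > 0 \<and> k1 \<omega> \<ge> 0 \<and> k2 \<omega> \<ge> 0 \<and> k3 \<omega> \<ge> 0 \<and>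
       \<phi>1 (y1 \<omega> / y2 \<omega>) \<le> ennreal (k1 \<omega> / y2 \<omega>) \<and>
       \<phi>2 (y2 \<omega> / y3 \<omega>) \<le> ennreal (k2 \<omega> / y3 \<omega>) \<and>
       \<phi>3 (y3 \<omega>) \<le> ennreal (k3 \<omega>))"

lemma admissible_lincomb:
  assumes \<phi>: "\<phi>1 \<in> Phi0" "\<phi>2 \<in> Phi0" "\<phi>3 \<in> Phi0"
    and uv: "0 \<le> u" "0 \<le> v" "u + v = 1"
    and y: "admissible \<phi>1 \<phi>2 \<phi>3 M y1 y2 y3 k1 k2 k3"
    and z: "admissible \<phi>1 \<phi>2 \<phi>3 M z1 z2 z3 m1 m2 m3"
  shows "admissible \<phi>1 \<phi>2 \<phi>3 M
    (\<lambda>\<omega>. u * y1 \<omega> + v * z1 \<omega>) (\<lambda>\<omega>. u * y2 \<omega> + v * z2 \<omega>) (\<lambda>\<omega>. u * y3 \<omega> + v * z3 \<omega>)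
    (\<lambda>\<omega>. u * k1 \<omega> + v * m1 \<omega>) (\<lambda>\<omega>. u * k2 \<omega> + v * m2 \<omega>) (\<lambda>\<omega>. u * k3 \<omega> + v * m3 \<omega>)"
proof -
  have pos: "u * a + v * b > 0" if "a > 0" "b > 0" for a b :: real
  proof (cases "u = 0")
    case True
    then show ?thesis using uv that by simp
  next
    case False
    then show ?thesis using uv that by (intro add_pos_nonneg) auto
  qed
  \<comment> \<open>The perspective with both denominators equal to 1, where
    \<open>u + v = 1\<close> keeps the combined denominator at 1.\<close>
  have "\<phi>3 (u * y3 \<omega> + v * z3 \<omega>) \<le> ennreal (u * k3 \<omega> + v * m3 \<omega>)" for \<omega>
    using Phi0_perspective_convex[OF \<phi>(3) uv, of 1 1 "k3 \<omega>" "m3 \<omega>" "y3 \<omega>" "z3 \<omega>"] y z uv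
    by (simp add: admissible_def)
  then show ?thesis
    using y z uv unfolding admissible_def
    by (auto intro!: bounded_rv_lincomb pos Phi0_perspective_convex \<phi>)
qed

text \<open>\<open>a\<close>, \<open>b\<close>, \<open>c\<close> are the successive ratios of the
  three densities. At \<open>a = b = c = 1\<close> the tuple is normalised and has cost 0; ratios
  near 1 perturb the normalisations.\<close>

lemma admissible_const:
  assumes "\<phi>1 a < \<infinity>" "\<phi>2 b < \<infinity>" "\<phi>3 c < \<infinity>" "a > 0" "b > 0" "c > 0"
  shows "admissible \<phi>1 \<phi>2 \<phi>3 M (\<lambda>_. a * b * c) (\<lambda>_. b * c) (\<lambda>_. c)
    (\<lambda>_. b * c * enn2real (\<phi>1 a)) (\<lambda>_. c * enn2real (\<phi>2 b)) (\<lambda>_. enn2real (\<phi>3 c))"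
  using assms by (auto simp: admissible_def)

text \<open>By positivity \<open>z / y\<close> is a density of the second measure with respect to
  the first, and uniqueness of Radon-Nikodym derivatives puts it in place of \<open>RN_deriv\<close>
  in the divergence.\<close>

lemma density_divergence:
  assumes lsc: "lower_semicont \<phi>"
    and [measurable]: "y \<in> borel_measurable M" "z \<in> borel_measurable M"
    and pos: "\<And>\<omega>. y \<omega> > 0" "\<And>\<omega>. z \<omega> > 0"
    and "prob_space (density M (\<lambda>\<omega>. ennreal (y \<omega>)))"
  shows "absolutely_continuous (density M (\<lambda>\<omega>. ennreal (y \<omega>))) (density M (\<lambda>\<omega>. ennreal (z \<omega>)))"
    and "phi_divergence \<phi> (density M (\<lambda>\<omega>. ennreal (z \<omega>))) (density M (\<lambda>\<omega>. ennreal (y \<omega>)))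
      = (\<integral>\<^sup>+ \<omega>. ennreal (y \<omega>) * \<phi> (z \<omega> / y \<omega>) \<partial>M)"
proof -
  let ?P = "density M (\<lambda>\<omega>. ennreal (y \<omega>))" and ?Q = "density M (\<lambda>\<omega>. ennreal (z \<omega>))"
  interpret P: prob_space ?P by fact
  have [measurable]: "\<phi> \<in> borel_measurable borel" by (rule lower_semicont_measurable) fact
  have "ennreal (y \<omega>) * ennreal (z \<omega> / y \<omega>) = ennreal (z \<omega>)" for \<omega>
    using pos[of \<omega>] by (simp add: less_imp_le flip: ennreal_mult)
  then have Q: "density ?P (\<lambda>\<omega>. ennreal (z \<omega> / y \<omega>)) = ?Q"
    by (subst density_density_eq) auto
  show ac: "absolutely_continuous ?P ?Q"
    using absolutely_continuousI_density[of "\<lambda>\<omega>. ennreal (z \<omega> / y \<omega>)" ?P] by (simp add: Q)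
  have "AE \<omega> in ?P. ennreal (z \<omega> / y \<omega>) = RN_deriv ?P ?Q \<omega>"
    by (rule P.RN_deriv_unique[OF _ Q]) simp
  then have "AE \<omega> in ?P. \<phi> (enn2real (RN_deriv ?P ?Q \<omega>)) = \<phi> (z \<omega> / y \<omega>)"
  proof eventually_elim
    case (elim \<omega>)
    then show ?case using pos[of \<omega>] by (simp add: less_imp_le flip: elim)
  qed
  then have "(\<integral>\<^sup>+ \<omega>. \<phi> (enn2real (RN_deriv ?P ?Q \<omega>)) \<partial>?P) = (\<integral>\<^sup>+ \<omega>. \<phi> (z \<omega> / y \<omega>) \<partial>?P)"
    by (rule nn_integral_cong_AE)
  also have "\<dots> = (\<integral>\<^sup>+ \<omega>. ennreal (y \<omega>) * \<phi> (z \<omega> / y \<omega>) \<partial>M)"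
    by (subst nn_integral_density) auto
  finally show "phi_divergence \<phi> ?Q ?P = (\<integral>\<^sup>+ \<omega>. ennreal (y \<omega>) * \<phi> (z \<omega> / y \<omega>) \<partial>M)"
    using ac by (simp add: phi_divergence_def)
qed

text \<open>The densities of a normalised tuple define measures \<open>P\<close>, \<open>Q\<close>,
  \<open>Q'\<close> over which the supremum is taken. Each divergence is at most the integral of the
  corresponding majorant, so the left-hand side can only be smaller than the objective at this
  triple.\<close>

lemma admissible_le_globalized_robust_oce:
  assumes "prob_space P0" and X: "integrable P0 X"
    and lsc: "lower_semicont \<phi>1" "lower_semicont \<phi>2" "lower_semicont \<phi>3"
    and adm: "admissible \<phi>1 \<phi>2 \<phi>3 P0 y1 y2 y3 k1 k2 k3"
    and norm: "(\<integral>\<omega>. y1 \<omega> \<partial>P0) = 1" "(\<integral>\<omega>. y2 \<omega> \<partial>P0) = 1" "(\<integral>\<omega>. y3 \<omega> \<partial>P0) = 1"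
    and le_r: "(\<integral>\<omega>. k3 \<omega> \<partial>P0) \<le> r"
  shows "ereal (- (\<integral>\<omega>. y1 \<omega> * X \<omega> \<partial>P0) - (\<integral>\<omega>. k1 \<omega> \<partial>P0) - (\<integral>\<omega>. k2 \<omega> \<partial>P0))
    \<le> globalized_robust_oce \<phi>1 \<phi>2 \<phi>3 r P0 X"
proof -
  interpret P0: prob_space P0 by fact
  have bd: "bounded_rv P0 y1" "bounded_rv P0 y2" "bounded_rv P0 y3"
      "bounded_rv P0 k1" "bounded_rv P0 k2" "bounded_rv P0 k3"
    and pos: "\<And>\<omega>. y1 \<omega> > 0" "\<And>\<omega>. y2 \<omega> > 0" "\<And>\<omega>. y3 \<omega> > 0"
      "\<And>\<omega>. k1 \<omega> \<ge> 0" "\<And>\<omega>. k2 \<omega> \<ge> 0" "\<And>\<omega>. k3 \<omega> \<ge> 0"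
    and cost: "\<And>\<omega>. \<phi>1 (y1 \<omega> / y2 \<omega>) \<le> ennreal (k1 \<omega> / y2 \<omega>)"
      "\<And>\<omega>. \<phi>2 (y2 \<omega> / y3 \<omega>) \<le> ennreal (k2 \<omega> / y3 \<omega>)" "\<And>\<omega>. \<phi>3 (y3 \<omega>) \<le> ennreal (k3 \<omega>)"
    using adm by (auto simp: admissible_def)
  note [measurable] = bd[THEN bounded_rv_measurable]
  have Xm[measurable]: "X \<in> borel_measurable P0" using X by simp
  have int: "(\<integral>\<^sup>+ \<omega>. ennreal (f \<omega>) \<partial>P0) = ennreal (\<integral>\<omega>. f \<omega> \<partial>P0)"
    if "bounded_rv P0 f" "\<And>\<omega>. f \<omega> \<ge> 0" for f
    using that by (intro nn_integral_eq_integral P0.bounded_rv_integrable) auto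
  define D where "D y = density P0 (\<lambda>\<omega>. ennreal (y \<omega>))" for y :: "'a \<Rightarrow> real"
  have D_prob: "prob_space (D y)"
    if "bounded_rv P0 y" "\<And>\<omega>. y \<omega> > 0" "(\<integral>\<omega>. y \<omega> \<partial>P0) = 1" for y
  proof
    have "y \<in> borel_measurable P0" using that(1) by (rule bounded_rv_measurable)
    then show "emeasure (D y) (space (D y)) = 1"
      using int[of y] that by (simp add: D_def emeasure_density less_imp_le cong: nn_integral_cong)
  qed
  have pr: "prob_space (D y1)" "prob_space (D y2)" "prob_space (D y3)"
    using D_prob bd pos norm by blast+
  have mem: "D y1 \<in> prob_measures_on P0" "D y2 \<in> prob_measures_on P0" "D y3 \<in> prob_measures_on P0"
    using pr by (auto simp: prob_measures_on_def D_def)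
  have D1: "D (\<lambda>_. 1) = P0" by (simp add: D_def density_1)
  note div1 = density_divergence[OF lsc(1), where M = P0 and y = y2 and z = y1, folded D_def, simplified pos pr, simplified]
  note div2 = density_divergence[OF lsc(2), where M = P0 and y = y3 and z = y2, folded D_def, simplified pos pr, simplified]
  note div3 = density_divergence[OF lsc(3), where M = P0 and y = "\<lambda>_. 1" and z = y3, folded D_def, unfolded D1, simplified pos assms(1), simplified]
  have scaled: "ennreal a * ennreal (b / a) = ennreal b" if "a > 0" "b \<ge> 0" for a b :: real
    using that by (simp flip: ennreal_mult)
  have bound: "(\<integral>\<^sup>+ \<omega>. ennreal (y \<omega>) * F \<omega> \<partial>P0) \<le> ennreal (\<integral>\<omega>. k \<omega> \<partial>P0)"
    if "\<And>\<omega>. y \<omega> > 0" "\<And>\<omega>. k \<omega> \<ge> 0" "bounded_rv P0 k" "\<And>\<omega>. F \<omega> \<le> ennreal (k \<omega> / y \<omega>)" for y k F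
  proof -
    have "(\<integral>\<^sup>+ \<omega>. ennreal (y \<omega>) * F \<omega> \<partial>P0) \<le> (\<integral>\<^sup>+ \<omega>. ennreal (k \<omega>) \<partial>P0)"
    proof (rule nn_integral_mono)
      fix \<omega>
      have "ennreal (y \<omega>) * F \<omega> \<le> ennreal (y \<omega>) * ennreal (k \<omega> / y \<omega>)"
        by (intro mult_left_mono that) simp
      then show "ennreal (y \<omega>) * F \<omega> \<le> ennreal (k \<omega>)"
        using scaled[of "y \<omega>" "k \<omega>"] that by simp
    qed
    then show ?thesis using int[of k] that by simp
  qed
  have b1: "phi_divergence \<phi>1 (D y1) (D y2) \<le> ennreal (\<integral>\<omega>. k1 \<omega> \<partial>P0)"
    unfolding div1(2) by (rule bound) (use pos bd cost in auto)
  have b2: "phi_divergence \<phi>2 (D y2) (D y3) \<le> ennreal (\<integral>\<omega>. k2 \<omega> \<partial>P0)"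
    unfolding div2(2) by (rule bound) (use pos bd cost in auto)
  have "phi_divergence \<phi>3 (D y3) P0 \<le> ennreal (\<integral>\<omega>. k3 \<omega> \<partial>P0)"
    using bound[of "\<lambda>_. 1" k3 "\<lambda>\<omega>. \<phi>3 (y3 \<omega>)"] pos bd cost by (simp add: div3(2))
  also have "\<dots> \<le> ennreal r" by (intro ennreal_leI le_r)
  finally have b3: "phi_divergence \<phi>3 (D y3) P0 \<le> ennreal r" .
  have yX: "integrable P0 (\<lambda>\<omega>. y1 \<omega> * X \<omega>)" by (rule bounded_rv_integrable_mult[OF bd(1) X])
  have "integrable (D y1) (\<lambda>\<omega>. - X \<omega>)"
    unfolding D_def using pos(1) yX by (subst integrable_real_density) (auto simp: less_imp_le)
  then have "ext_expectation (D y1) (\<lambda>\<omega>. ereal (- X \<omega>)) = ereal (\<integral>\<omega>. - X \<omega> \<partial>D y1)"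
    by (rule ext_expectation_integrable)
  also have "(\<integral>\<omega>. - X \<omega> \<partial>D y1) = - (\<integral>\<omega>. y1 \<omega> * X \<omega> \<partial>P0)"
    unfolding D_def using pos(1) by (subst integral_real_density) (auto simp: less_imp_le)
  finally have ex: "ext_expectation (D y1) (\<lambda>\<omega>. ereal (- X \<omega>)) = ereal (- (\<integral>\<omega>. y1 \<omega> * X \<omega> \<partial>P0))" .
  have k0: "(\<integral>\<omega>. k1 \<omega> \<partial>P0) \<ge> 0" "(\<integral>\<omega>. k2 \<omega> \<partial>P0) \<ge> 0" using pos by auto
  have "ereal (- (\<integral>\<omega>. y1 \<omega> * X \<omega> \<partial>P0) - (\<integral>\<omega>. k1 \<omega> \<partial>P0) - (\<integral>\<omega>. k2 \<omega> \<partial>P0))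
      = ereal (- (\<integral>\<omega>. y1 \<omega> * X \<omega> \<partial>P0)) \<ominus>\<^sub>l ereal (\<integral>\<omega>. k1 \<omega> \<partial>P0) \<ominus>\<^sub>l ereal (\<integral>\<omega>. k2 \<omega> \<partial>P0)"
    by (simp add: lower_minus_def)
  also have "\<dots> \<le> ext_expectation (D y1) (\<lambda>\<omega>. ereal (- X \<omega>))
      \<ominus>\<^sub>l enn2ereal (phi_divergence \<phi>1 (D y1) (D y2)) \<ominus>\<^sub>l enn2ereal (phi_divergence \<phi>2 (D y2) (D y3))"
    unfolding ex using b1 b2 k0
    by (intro lower_minus_mono order_refl) (auto simp: less_eq_ennreal.rep_eq enn2ereal_ennreal)
  also have "\<dots> \<le> globalized_robust_oce \<phi>1 \<phi>2 \<phi>3 r P0 X"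
    unfolding globalized_robust_oce_def
    by (rule SUP_upper2[of "D y3"], use mem b3 in simp, rule SUP_upper2[of "D y2"],
        use mem div2(1) in simp, rule SUP_upper2[of "D y1"], use mem div1(1) in simp, rule order_refl)
  finally show ?thesis .
qed

section \<open>Lagrange multipliers by separation\<close>

lemma Phi0_finite_near_1:
  assumes "\<phi> \<in> Phi0"
  obtains e where "0 < e" "e < 1" "\<And>d. \<bar>d\<bar> \<le> e \<Longrightarrow> \<phi> (1 + d) < \<infinity>"
proof -
  have "1 \<in> interior (eff_dom \<phi>)" using assms by (simp add: Phi0_def)
  then obtain e where e: "e > 0" "cball 1 e \<subseteq> eff_dom \<phi>"
    by (auto simp: mem_interior_cball)
  show thesis
  \<comment> \<open>The cap 1/2 keeps \<open>1 + d\<close> positive, as the densities of an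
    admissible tuple must be.\<close>
  proof (rule that[of "min e (1/2)"])
    fix d :: real assume "\<bar>d\<bar> \<le> min e (1/2)"
    then have "1 + d \<in> cball 1 e" by (simp add: dist_real_def)
    then show "\<phi> (1 + d) < \<infinity>" using e by (auto simp: eff_dom_def)
  qed (use e in auto)
qed

text \<open>Only the part that depends on the tuple; the constants -\<theta>1 - \<theta>2 -
  \<theta>3 + l r are left out. The numbering is crossed: \<open>\<theta>3\<close> belongs to
  \<open>y1\<close> and \<open>\<theta>1\<close> to \<open>y3\<close>, following the nesting of the
  conjugates.\<close>

definition lagrangian :: "'a measure \<Rightarrow> ('a \<Rightarrow> real) \<Rightarrow> real \<Rightarrow> real \<Rightarrow> real \<Rightarrow> real \<Rightarrow>
    ('a \<Rightarrow> real) \<Rightarrow> ('a \<Rightarrow> real) \<Rightarrow> ('a \<Rightarrow> real) \<Rightarrow>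
    ('a \<Rightarrow> real) \<Rightarrow> ('a \<Rightarrow> real) \<Rightarrow> ('a \<Rightarrow> real) \<Rightarrow> real"
where
  "lagrangian M X \<theta>1 \<theta>2 \<theta>3 l y1 y2 y3 k1 k2 k3 =
     - (\<integral>\<omega>. y1 \<omega> * X \<omega> \<partial>M) - (\<integral>\<omega>. k1 \<omega> \<partial>M) - (\<integral>\<omega>. k2 \<omega> \<partial>M)
     + \<theta>3 * (\<integral>\<omega>. y1 \<omega> \<partial>M) + \<theta>2 * (\<integral>\<omega>. y2 \<omega> \<partial>M) + \<theta>1 * (\<integral>\<omega>. y3 \<omega> \<partial>M)
     - l * (\<integral>\<omega>. k3 \<omega> \<partial>M)"

text \<open>
  Separation of the attainable values of (constraints, objective) from the values that would beat
  \<open>V\<close>. The normal vector is not vertical because constant tuples attain every small perturbation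
  of the normalisation constraints (\<open>1\<close> is interior to the domains) and \<open>r > 0\<close>.
\<close>

lemma lagrange_multipliers:
  assumes "prob_space P0" and X: "integrable P0 X"
    and \<phi>: "\<phi>1 \<in> Phi0" "\<phi>2 \<in> Phi0" "\<phi>3 \<in> Phi0" and r: "r > 0"
    and V: "\<And>y1 y2 y3 k1 k2 k3. admissible \<phi>1 \<phi>2 \<phi>3 P0 y1 y2 y3 k1 k2 k3 \<Longrightarrow>
      (\<integral>\<omega>. y1 \<omega> \<partial>P0) = 1 \<Longrightarrow> (\<integral>\<omega>. y2 \<omega> \<partial>P0) = 1 \<Longrightarrow> (\<integral>\<omega>. y3 \<omega> \<partial>P0) = 1 \<Longrightarrow>
      (\<integral>\<omega>. k3 \<omega> \<partial>P0) \<le> r \<Longrightarrow>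
      - (\<integral>\<omega>. y1 \<omega> * X \<omega> \<partial>P0) - (\<integral>\<omega>. k1 \<omega> \<partial>P0) - (\<integral>\<omega>. k2 \<omega> \<partial>P0) \<le> V"
  obtains \<theta>1 \<theta>2 \<theta>3 l :: real where "l \<ge> 0"
    "\<And>y1 y2 y3 k1 k2 k3. admissible \<phi>1 \<phi>2 \<phi>3 P0 y1 y2 y3 k1 k2 k3 \<Longrightarrow>
      lagrangian P0 X \<theta>1 \<theta>2 \<theta>3 l y1 y2 y3 k1 k2 k3 \<le> V + \<theta>1 + \<theta>2 + \<theta>3 - l * r"
proof -
  interpret P0: prob_space P0 by fact
  \<comment> \<open>The first four coordinates are the constrained quantities, the fifth is the
    objective.\<close>
  define pt where "pt y1 y2 y3 k1 k2 k3 =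
    ((\<integral>\<omega>. y1 \<omega> \<partial>P0), (\<integral>\<omega>. y2 \<omega> \<partial>P0), (\<integral>\<omega>. y3 \<omega> \<partial>P0), (\<integral>\<omega>. k3 \<omega> \<partial>P0),
      - (\<integral>\<omega>. y1 \<omega> * X \<omega> \<partial>P0) - (\<integral>\<omega>. k1 \<omega> \<partial>P0) - (\<integral>\<omega>. k2 \<omega> \<partial>P0))"
    for y1 y2 y3 k1 k2 k3 :: "'a \<Rightarrow> real"
  define S where "S = {pt y1 y2 y3 k1 k2 k3 | y1 y2 y3 k1 k2 k3.
    admissible \<phi>1 \<phi>2 \<phi>3 P0 y1 y2 y3 k1 k2 k3}"
  define T where "T = {(1::real, 1::real, 1::real, c::real, v::real) | c v. c \<le> r \<and> v > V}"
  have "convex S"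
  proof (rule convexI)
    fix p q :: "real \<times> real \<times> real \<times> real \<times> real" and u v :: real
    assume p: "p \<in> S" and q: "q \<in> S" and uv: "0 \<le> u" "0 \<le> v" "u + v = 1"
    obtain y1 y2 y3 k1 k2 k3 where y: "p = pt y1 y2 y3 k1 k2 k3"
      "admissible \<phi>1 \<phi>2 \<phi>3 P0 y1 y2 y3 k1 k2 k3" using p by (auto simp: S_def)
    obtain z1 z2 z3 m1 m2 m3 where z: "q = pt z1 z2 z3 m1 m2 m3"
      "admissible \<phi>1 \<phi>2 \<phi>3 P0 z1 z2 z3 m1 m2 m3" using q by (auto simp: S_def)
    note adm = admissible_lincomb[OF \<phi> uv y(2) z(2)]
    have bd: "bounded_rv P0 f" if "f \<in> {y1, y2, y3, k1, k2, k3, z1, z2, z3, m1, m2, m3}" for f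
      using that y(2) z(2) unfolding admissible_def by blast
    then have int: "integrable P0 f" if "f \<in> {y1, y2, y3, k1, k2, k3, z1, z2, z3, m1, m2, m3}" for f
      using that P0.bounded_rv_integrable by blast
    have intX: "integrable P0 (\<lambda>\<omega>. y1 \<omega> * X \<omega>)" "integrable P0 (\<lambda>\<omega>. z1 \<omega> * X \<omega>)"
      using bounded_rv_integrable_mult[OF bd X] by auto
    have "(u * y1 \<omega> + v * z1 \<omega>) * X \<omega> = u * (y1 \<omega> * X \<omega>) + v * (z1 \<omega> * X \<omega>)" for \<omega>
      by (simp add: algebra_simps)
    then have "u *\<^sub>R p + v *\<^sub>R q = pt
      (\<lambda>\<omega>. u * y1 \<omega> + v * z1 \<omega>) (\<lambda>\<omega>. u * y2 \<omega> + v * z2 \<omega>) (\<lambda>\<omega>. u * y3 \<omega> + v * z3 \<omega>)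
      (\<lambda>\<omega>. u * k1 \<omega> + v * m1 \<omega>) (\<lambda>\<omega>. u * k2 \<omega> + v * m2 \<omega>) (\<lambda>\<omega>. u * k3 \<omega> + v * m3 \<omega>)"
      unfolding y(1) z(1) by (simp add: pt_def int intX) (simp add: algebra_simps)
    then show "u *\<^sub>R p + v *\<^sub>R q \<in> S" using adm unfolding S_def by blast
  qed
  moreover have "convex T"
  proof (rule convexI)
    fix p q :: "real \<times> real \<times> real \<times> real \<times> real" and u v :: real
    assume p: "p \<in> T" and q: "q \<in> T" and uv: "0 \<le> u" "0 \<le> v" "u + v = 1"
    obtain a b where a: "p = (1, 1, 1, a, b)" "a \<le> r" "b > V" using p by (auto simp: T_def)
    obtain c d where c: "q = (1, 1, 1, c, d)" "c \<le> r" "d > V" using q by (auto simp: T_def)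
    have "u * a + v * c \<le> r" using convex_bound_le a c uv by blast
    moreover have "u * (- b) + v * (- d) < - V" using convex_bound_lt[of "-b" "-V" "-d"] a c uv by simp
    ultimately show "u *\<^sub>R p + v *\<^sub>R q \<in> T" using a c uv by (auto simp: T_def)
  qed
  moreover have const_in: "pt (\<lambda>_. a * b * c) (\<lambda>_. b * c) (\<lambda>_. c) (\<lambda>_. b * c * enn2real (\<phi>1 a))
      (\<lambda>_. c * enn2real (\<phi>2 b)) (\<lambda>_. enn2real (\<phi>3 c)) \<in> S"
    if "\<phi>1 a < \<infinity>" "\<phi>2 b < \<infinity>" "\<phi>3 c < \<infinity>" "a > 0" "b > 0" "c > 0" for a b c
    unfolding S_def using admissible_const[of \<phi>1 a \<phi>2 b \<phi>3 c, OF that] by blast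
  have \<phi>1: "\<phi>1 1 = 0" "\<phi>2 1 = 0" "\<phi>3 1 = 0" using \<phi> by (auto simp: Phi0_def)
  have "S \<noteq> {}" using const_in[of 1 1 1] \<phi>1 by auto
  moreover have "T \<noteq> {}" by (auto simp: T_def intro: gt_ex)
  moreover have "S \<inter> T = {}"
  proof -
    have False if pS: "p \<in> S" and pT: "p \<in> T" for p
    proof -
      obtain y1 y2 y3 k1 k2 k3 where "p = pt y1 y2 y3 k1 k2 k3"
        "admissible \<phi>1 \<phi>2 \<phi>3 P0 y1 y2 y3 k1 k2 k3" using pS unfolding S_def by blast
      then show False using V[of y1 y2 y3 k1 k2 k3] pT by (auto simp: T_def pt_def)
    qed
    then show ?thesis by blast
  qed
  ultimately obtain a b where a: "a \<noteq> 0" and Sb: "\<And>p. p \<in> S \<Longrightarrow> inner a p \<le> b"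
    and Tb: "\<And>p. p \<in> T \<Longrightarrow> inner a p \<ge> b"
    using separating_hyperplane_sets[of S T] by blast
  obtain a1 a2 a3 a4 a5 where a_eq: "a = (a1, a2, a3, a4, a5)" by (cases a) auto
  have Tb': "b \<le> a1 + a2 + a3 + a4 * c + a5 * v" if "c \<le> r" "v > V" for c v
    using Tb[of "(1, 1, 1, c, v)"] that by (simp add: T_def a_eq inner_prod_def)
  \<comment> \<open>\<open>T\<close> is unbounded upwards in its last coordinate and downwards in
    its fourth, which fixes the signs of \<open>a5\<close> and \<open>a4\<close>. In both
    contradictions \<open>K\<close> is where the affine function takes the value \<open>b\<close>;
    beyond it the function drops below \<open>b\<close>.\<close>
  have a5: "a5 \<ge> 0"
  proof (rule ccontr)
    assume "\<not> a5 \<ge> 0"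
    define K where "K = (b - a1 - a2 - a3 - a4 * r) / a5"
    have "b \<le> a1 + a2 + a3 + a4 * r + a5 * (max K V + 1)" by (rule Tb') auto
    moreover have "a5 * (max K V + 1) < a5 * K" using \<open>\<not> a5 \<ge> 0\<close> by (intro mult_strict_left_mono_neg) auto
    moreover have "a5 * K = b - a1 - a2 - a3 - a4 * r" using \<open>\<not> a5 \<ge> 0\<close> by (simp add: K_def)
    ultimately show False by simp
  qed
  have a4: "a4 \<le> 0"
  proof (rule ccontr)
    assume "\<not> a4 \<le> 0"
    define K where "K = (b - a1 - a2 - a3 - a5 * (V + 1)) / a4"
    have "b \<le> a1 + a2 + a3 + a4 * (min K r - 1) + a5 * (V + 1)" by (rule Tb') auto
    moreover have "a4 * (min K r - 1) < a4 * K" using \<open>\<not> a4 \<le> 0\<close> by (intro mult_strict_left_mono) auto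
    moreover have "a4 * K = b - a1 - a2 - a3 - a5 * (V + 1)" using \<open>\<not> a4 \<le> 0\<close> by (simp add: K_def)
    ultimately show False by simp
  qed
  \<comment> \<open>\<open>T\<close> requires \<open>v > V\<close> strictly, so the value at
    \<open>V\<close> is reached as a limit from the right.\<close>
  have bV: "b \<le> a1 + a2 + a3 + a4 * r + a5 * V"
  proof -
    have "((\<lambda>v. a1 + a2 + a3 + a4 * r + a5 * v) \<longlongrightarrow> a1 + a2 + a3 + a4 * r + a5 * V) (at_right V)"
      by (intro tendsto_intros)
    moreover have "eventually (\<lambda>v. b \<le> a1 + a2 + a3 + a4 * r + a5 * v) (at_right V)"
      unfolding eventually_at_right_field using Tb'[of r] by (auto intro: gt_ex)
    ultimately show ?thesis by (rule tendsto_lowerbound) simp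
  qed
  have S_le: "a1 * p1 + a2 * p2 + a3 * p3 + a4 * p4 + a5 * p5 \<le> a1 + a2 + a3 + a4 * r + a5 * V"
    if "(p1, p2, p3, p4, p5) \<in> S" for p1 p2 p3 p4 p5
    using Sb[OF that] bV by (simp add: a_eq inner_prod_def)
  have "a5 \<noteq> 0"
  proof
    assume a50: "a5 = 0"
    have perturb: "a1 * (x * y * z) + a2 * (y * z) + a3 * z + a4 * enn2real (\<phi>3 z) \<le> a1 + a2 + a3 + a4 * r"
      if "\<phi>1 x < \<infinity>" "\<phi>2 y < \<infinity>" "\<phi>3 z < \<infinity>" "x > 0" "y > 0" "z > 0" for x y z
      using const_in[OF that] a50 S_le by (simp add: pt_def P0.prob_space)
    \<comment> \<open>At ratios 1 all terms but those in \<open>a4\<close> cancel, and the sign of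
      \<open>a4\<close> with \<open>r > 0\<close> forces \<open>a4 = 0\<close>. Moving
      \<open>x\<close> then changes only the first density, moving \<open>y\<close> the first two,
      moving \<open>z\<close> all three; so \<open>a1\<close>, \<open>a1 + a2\<close> and
      \<open>a1 + a2 + a3\<close> vanish in turn.\<close>
    have "a4 * r \<ge> 0" using perturb[of 1 1 1] \<phi>1 by simp
    then have a40: "a4 = 0" using a4 r by (simp add: zero_le_mult_iff)
    have zero: "A = 0" if "\<And>d. \<bar>d\<bar> \<le> e \<Longrightarrow> A * d \<le> 0" "e > 0" for A e :: real
      using that(1)[of e] that(1)[of "-e"] that(2) by (simp add: mult_le_0_iff zero_le_mult_iff)
    obtain e1 where e1: "0 < e1" "e1 < 1" "\<And>d. \<bar>d\<bar> \<le> e1 \<Longrightarrow> \<phi>1 (1 + d) < \<infinity>"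
      using Phi0_finite_near_1[OF \<phi>(1)] by blast
    have "a1 = 0"
    proof (rule zero[OF _ e1(1)])
      fix d :: real assume d: "\<bar>d\<bar> \<le> e1"
      then have "0 < 1 + d" using e1(2) by linarith
      then show "a1 * d \<le> 0" using perturb[of "1 + d" 1 1] e1(3)[OF d] \<phi>1 a40 by (simp add: distrib_left distrib_right)
    qed
    moreover
    obtain e2 where e2: "0 < e2" "e2 < 1" "\<And>d. \<bar>d\<bar> \<le> e2 \<Longrightarrow> \<phi>2 (1 + d) < \<infinity>"
      using Phi0_finite_near_1[OF \<phi>(2)] by blast
    have "a1 + a2 = 0"
    proof (rule zero[OF _ e2(1)])
      fix d :: real assume d: "\<bar>d\<bar> \<le> e2"
      then have "0 < 1 + d" using e2(2) by linarith
      then show "(a1 + a2) * d \<le> 0" using perturb[of 1 "1 + d" 1] e2(3)[OF d] \<phi>1 a40 by (simp add: distrib_left distrib_right)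
    qed
    moreover
    obtain e3 where e3: "0 < e3" "e3 < 1" "\<And>d. \<bar>d\<bar> \<le> e3 \<Longrightarrow> \<phi>3 (1 + d) < \<infinity>"
      using Phi0_finite_near_1[OF \<phi>(3)] by blast
    have "a1 + a2 + a3 = 0"
    proof (rule zero[OF _ e3(1)])
      fix d :: real assume d: "\<bar>d\<bar> \<le> e3"
      then have "0 < 1 + d" using e3(2) by linarith
      then show "(a1 + a2 + a3) * d \<le> 0" using perturb[of 1 1 "1 + d"] e3(3)[OF d] \<phi>1 a40 by (simp add: distrib_left distrib_right)
    qed
    ultimately show False using a a_eq a40 a50 by (simp add: zero_prod_def)
  qed
  with a5 have a5: "a5 > 0" by simp
  show thesis
  \<comment> \<open>Scaling the normal vector so that the objective has coefficient 1;
    \<open>a3\<close> yields \<open>\<theta>1\<close> because it multiplies the integral of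
    \<open>y3\<close>.\<close>
  proof (rule that[of "- a4 / a5" "a3 / a5" "a2 / a5" "a1 / a5"])
    show "0 \<le> - a4 / a5" using a4 a5 by (simp add: divide_nonpos_pos)
    fix y1 y2 y3 k1 k2 k3 assume adm: "admissible \<phi>1 \<phi>2 \<phi>3 P0 y1 y2 y3 k1 k2 k3"
    define p1 p2 p3 p4 p5 where p: "p1 = (\<integral>\<omega>. y1 \<omega> \<partial>P0)" "p2 = (\<integral>\<omega>. y2 \<omega> \<partial>P0)"
      "p3 = (\<integral>\<omega>. y3 \<omega> \<partial>P0)" "p4 = (\<integral>\<omega>. k3 \<omega> \<partial>P0)"
      "p5 = - (\<integral>\<omega>. y1 \<omega> * X \<omega> \<partial>P0) - (\<integral>\<omega>. k1 \<omega> \<partial>P0) - (\<integral>\<omega>. k2 \<omega> \<partial>P0)"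
    have "(p1, p2, p3, p4, p5) = pt y1 y2 y3 k1 k2 k3" by (simp add: p pt_def)
    then have "(p1, p2, p3, p4, p5) \<in> S" using adm unfolding S_def by blast
    from divide_right_mono[OF S_le[OF this] less_imp_le[OF a5]]
    have "p5 + a1 / a5 * p1 + a2 / a5 * p2 + a3 / a5 * p3 - (- a4 / a5) * p4
      \<le> V + a3 / a5 + a2 / a5 + a1 / a5 - (- a4 / a5) * r"
      using a5 by (simp add: add_divide_distrib)
    then show "lagrangian P0 X (a3 / a5) (a2 / a5) (a1 / a5) (- a4 / a5) y1 y2 y3 k1 k2 k3 \<le> V + a3 / a5 + a2 / a5 + a1 / a5 - (- a4 / a5) * r"
      unfolding p lagrangian_def .
  qed
qed

section \<open>Supremum of the Lagrangian and strong duality\<close>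

lemma bounded_rv_selection:
  assumes [measurable]: "\<nu> \<in> measurable M (count_space UNIV)" and "\<And>\<omega>. \<nu> \<omega> \<le> (N::nat)"
  shows "bounded_rv M (\<lambda>\<omega>. h (\<nu> \<omega>) :: real)"
proof -
  have "range (\<lambda>\<omega>. h (\<nu> \<omega>)) \<subseteq> h ` {..N}" using assms(2) by auto
  then have "bounded (range (\<lambda>\<omega>. h (\<nu> \<omega>)))"
    by (rule bounded_subset[rotated]) (simp add: finite_imp_bounded)
  then show ?thesis by (simp add: bounded_rv_def)
qed

text \<open>The countable affine forms are inserted from the inside outwards. The slopes
  \<open>t2\<close> and \<open>t3\<close> are positive, so they pass through the inner suprema,
  leaving functions affine in \<open>x\<close> indexed by triples.\<close>

lemma nested_conjugate_le_SUP:
  assumes pos: "\<And>n. t2 n > 0" "\<And>n. t3 n > 0"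
    and \<phi>: "\<phi>1 \<in> Phi0" "\<phi>2 \<in> Phi0" "\<phi>3 \<in> Phi0" and "l > 0"
    and c1: "\<And>s. s \<noteq> -\<infinity> \<Longrightarrow> convex_conjugate \<phi>1 s = (SUP n. ereal (t1 n) * s + ereal (- c1 n))"
    and c2: "\<And>s. s \<noteq> -\<infinity> \<Longrightarrow> convex_conjugate \<phi>2 s = (SUP n. ereal (t2 n) * s + ereal (- c2 n))"
    and c3: "\<And>s. s \<noteq> -\<infinity> \<Longrightarrow> convex_conjugate \<phi>3 s = (SUP n. ereal (t3 n) * s + ereal (- c3 n))"
  shows "conjugate_persp \<phi>3 l (convex_conjugate \<phi>2 (convex_conjugate \<phi>1 (ereal x) + ereal \<theta>2) + ereal \<theta>1)
    \<le> (SUP (i::nat, j::nat, k::nat).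
        ereal (t3 k * (t2 j * (t1 i * x - c1 i + \<theta>2) - c2 j + \<theta>1) - l * c3 k))"
proof -
  define f1 where "f1 = convex_conjugate \<phi>1 (ereal x) + ereal \<theta>2"
  define f2 where "f2 = convex_conjugate \<phi>2 f1 + ereal \<theta>1"
  have f1_nm: "f1 \<noteq> -\<infinity>"
    using convex_conjugate_ge[OF \<phi>(1), of "ereal x"] by (auto simp: f1_def)
  have f2_nm: "f2 \<noteq> -\<infinity>"
    using convex_conjugate_ge[OF \<phi>(2), of f1] f1_nm by (auto simp: f2_def)
  have f1: "f1 = (SUP i. ereal (t1 i * x - c1 i + \<theta>2))"
    using ereal_affine_SUP[of 1 "\<lambda>i. ereal (t1 i) * ereal x + ereal (- c1 i)" \<theta>2]
    by (simp add: f1_def c1 flip: one_ereal_def)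
  have f2: "f2 = (SUP j i. ereal (t2 j * (t1 i * x - c1 i + \<theta>2) - c2 j + \<theta>1))"
  proof -
    have "f2 = (SUP j. ereal (t2 j) * f1 + ereal (- c2 j + \<theta>1))"
      using ereal_affine_SUP[of 1 "\<lambda>j. ereal (t2 j) * f1 + ereal (- c2 j)" \<theta>1] f1_nm
      by (simp add: f2_def c2 add.assoc flip: one_ereal_def)
    also have "\<dots> = (SUP j i. ereal (t2 j * (t1 i * x - c1 i + \<theta>2) - c2 j + \<theta>1))"
      unfolding f1 ereal_affine_SUP[OF pos(1)] by (simp add: algebra_simps)
    finally show ?thesis .
  qed
  have "conjugate_persp \<phi>3 l f2 = (SUP k. ereal (t3 k) * f2 + ereal (- l * c3 k))"
    by (rule conjugate_persp_countable[OF \<phi>(3) \<open>l > 0\<close> c3 f2_nm])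
  also have "\<dots> = (SUP k j i. ereal (t3 k * (t2 j * (t1 i * x - c1 i + \<theta>2) - c2 j + \<theta>1) - l * c3 k))"
    unfolding f2 ereal_affine_SUP[OF pos(2)] by simp
  also have "\<dots> \<le> (SUP (i, j, k). ereal (t3 k * (t2 j * (t1 i * x - c1 i + \<theta>2) - c2 j + \<theta>1) - l * c3 k))"
  proof (intro SUP_least)
    fix k j i
    show "ereal (t3 k * (t2 j * (t1 i * x - c1 i + \<theta>2) - c2 j + \<theta>1) - l * c3 k)
        \<le> (SUP (i, j, k). ereal (t3 k * (t2 j * (t1 i * x - c1 i + \<theta>2) - c2 j + \<theta>1) - l * c3 k))"
      by (rule SUP_upper2[of "(i, j, k)"]) auto
  qed
  finally show ?thesis by (simp add: f1_def f2_def)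
qed

text \<open>Each index triple of the nested supremum is a choice of three density ratios, and the
  affine function it contributes is the integrand of the Lagrangian there. A finitely valued
  measurable choice of triples is an admissible tuple, so \<open>bound\<close> controls all
  selections and hence the supremum.\<close>

lemma dual_value_le:
  fixes P0 :: "'a measure" and l \<theta>1 \<theta>2 \<theta>3 C :: real
  assumes "prob_space P0" and X: "integrable P0 X"
    and \<phi>: "\<phi>1 \<in> Phi0" "\<phi>2 \<in> Phi0" "\<phi>3 \<in> Phi0" and l: "l > 0"
    and bound: "\<And>y1 y2 y3 k1 k2 k3. admissible \<phi>1 \<phi>2 \<phi>3 P0 y1 y2 y3 k1 k2 k3 \<Longrightarrow>
      lagrangian P0 X \<theta>1 \<theta>2 \<theta>3 l y1 y2 y3 k1 k2 k3 \<le> C"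
  shows "ext_expectation P0 (\<lambda>\<omega>. conjugate_persp \<phi>3 l
    (convex_conjugate \<phi>2 (convex_conjugate \<phi>1 (ereal (\<theta>3 - X \<omega>)) + ereal \<theta>2) + ereal \<theta>1)) \<le> ereal C"
proof -
  interpret P0: prob_space P0 by fact
  obtain t1 d1 :: "nat \<Rightarrow> real" where 1: "\<And>n. t1 n > 0" "\<And>n. d1 n \<ge> 0" "\<And>n. \<phi>1 (t1 n) \<le> ennreal (d1 n)"
    "\<And>s. s \<noteq> -\<infinity> \<Longrightarrow> convex_conjugate \<phi>1 s = (SUP n. ereal (t1 n) * s + ereal (- d1 n))"
    by (rule convex_conjugate_countable[OF \<phi>(1)]) blast
  obtain t2 d2 :: "nat \<Rightarrow> real" where 2: "\<And>n. t2 n > 0" "\<And>n. d2 n \<ge> 0" "\<And>n. \<phi>2 (t2 n) \<le> ennreal (d2 n)"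
    "\<And>s. s \<noteq> -\<infinity> \<Longrightarrow> convex_conjugate \<phi>2 s = (SUP n. ereal (t2 n) * s + ereal (- d2 n))"
    by (rule convex_conjugate_countable[OF \<phi>(2)]) blast
  obtain t3 d3 :: "nat \<Rightarrow> real" where 3: "\<And>n. t3 n > 0" "\<And>n. d3 n \<ge> 0" "\<And>n. \<phi>3 (t3 n) \<le> ennreal (d3 n)"
    "\<And>s. s \<noteq> -\<infinity> \<Longrightarrow> convex_conjugate \<phi>3 s = (SUP n. ereal (t3 n) * s + ereal (- d3 n))"
    by (rule convex_conjugate_countable[OF \<phi>(3)]) blast
  \<comment> \<open>\<open>\<tau>\<close> enumerates the triples. Densities are recovered as
    products of ratios, and \<open>m1\<close>, \<open>m2\<close> rescale the epigraph heights by the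
    denominators \<open>z2\<close>, \<open>z3\<close>.\<close>
  define \<tau> where "\<tau> = (from_nat :: nat \<Rightarrow> nat \<times> nat \<times> nat)"
  define z3 where "z3 n = t3 (snd (snd (\<tau> n)))" for n
  define z2 where "z2 n = t2 (fst (snd (\<tau> n))) * z3 n" for n
  define z1 where "z1 n = t1 (fst (\<tau> n)) * z2 n" for n
  define m1 where "m1 n = d1 (fst (\<tau> n)) * z2 n" for n
  define m2 where "m2 n = d2 (fst (snd (\<tau> n))) * z3 n" for n
  define m3 where "m3 n = d3 (snd (snd (\<tau> n)))" for n
  have zpos: "z1 n > 0" "z2 n > 0" "z3 n > 0" for n
    using 1 2 3 by (auto simp: z1_def z2_def z3_def)
  define A where "A n \<omega> = - (z1 n * X \<omega>) - m1 n - m2 n + \<theta>3 * z1 n + \<theta>2 * z2 n + \<theta>1 * z3 n - l * m3 n" for n \<omega>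
  have sel: "integrable P0 (\<lambda>\<omega>. A (\<nu> \<omega>) \<omega>) \<and> (\<integral>\<omega>. A (\<nu> \<omega>) \<omega> \<partial>P0) \<le> C"
    if \<nu>: "\<nu> \<in> measurable P0 (count_space UNIV)" "\<And>\<omega>. \<nu> \<omega> \<le> N" for \<nu> and N :: nat
  proof -
    have bd: "bounded_rv P0 (\<lambda>\<omega>. h (\<nu> \<omega>))" for h by (rule bounded_rv_selection[OF \<nu>])
    have int: "integrable P0 (\<lambda>\<omega>. h (\<nu> \<omega>))" for h :: "nat \<Rightarrow> real"
      by (rule P0.bounded_rv_integrable[OF bd])
    have intX: "integrable P0 (\<lambda>\<omega>. z1 (\<nu> \<omega>) * X \<omega>)" by (rule bounded_rv_integrable_mult[OF bd X])
    have "admissible \<phi>1 \<phi>2 \<phi>3 P0 (\<lambda>\<omega>. z1 (\<nu> \<omega>)) (\<lambda>\<omega>. z2 (\<nu> \<omega>)) (\<lambda>\<omega>. z3 (\<nu> \<omega>))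
        (\<lambda>\<omega>. m1 (\<nu> \<omega>)) (\<lambda>\<omega>. m2 (\<nu> \<omega>)) (\<lambda>\<omega>. m3 (\<nu> \<omega>))"
    proof -
      have "z1 n / z2 n = t1 (fst (\<tau> n))" "m1 n / z2 n = d1 (fst (\<tau> n))"
        "z2 n / z3 n = t2 (fst (snd (\<tau> n)))" "m2 n / z3 n = d2 (fst (snd (\<tau> n)))" for n
        using zpos[of n] by (auto simp: z1_def m1_def z2_def m2_def)
      moreover have "m1 n \<ge> 0" "m2 n \<ge> 0" "m3 n \<ge> 0" for n
        using 1 2 3 zpos[of n] by (auto simp: m1_def m2_def m3_def)
      ultimately show ?thesis
        using bd zpos 1(3) 2(3) 3(3) by (auto simp: admissible_def m3_def z3_def)
    qed
    from bound[OF this] show ?thesis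
      using int intX by (simp add: A_def lagrangian_def)
  qed
  have "ext_expectation P0 (\<lambda>\<omega>. conjugate_persp \<phi>3 l
      (convex_conjugate \<phi>2 (convex_conjugate \<phi>1 (ereal (\<theta>3 - X \<omega>)) + ereal \<theta>2) + ereal \<theta>1))
    \<le> ext_expectation P0 (\<lambda>\<omega>. SUP n. ereal (A n \<omega>))"
  proof (rule ext_expectation_mono)
    fix \<omega>
    let ?a = "\<lambda>i j k. t3 k * (t2 j * (t1 i * (\<theta>3 - X \<omega>) - d1 i + \<theta>2) - d2 j + \<theta>1) - l * d3 k"
    have "(SUP (i, j, k). ereal (?a i j k)) \<le> (SUP n. ereal (A n \<omega>))"
    proof (rule SUP_least, clarify)
      fix i j k :: nat
      have "?a i j k = A (to_nat (i, j, k)) \<omega>"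
        by (simp add: A_def z1_def z2_def z3_def m1_def m2_def m3_def \<tau>_def algebra_simps)
      then show "ereal (?a i j k) \<le> (SUP n. ereal (A n \<omega>))"
        by (intro SUP_upper2[of "to_nat (i, j, k)"]) simp_all
    qed
    with nested_conjugate_le_SUP[OF 2(1) 3(1) \<phi> l 1(4) 2(4) 3(4)]
    show "conjugate_persp \<phi>3 l (convex_conjugate \<phi>2 (convex_conjugate \<phi>1 (ereal (\<theta>3 - X \<omega>)) + ereal \<theta>2) + ereal \<theta>1)
      \<le> (SUP n. ereal (A n \<omega>))"
      by (rule order_trans)
  qed
  also have "\<dots> \<le> ereal C"
    by (rule ext_expectation_SUP_le) (use sel in blast)+
  finally show ?thesis .
qed

theorem theorem4:
  fixes P0 :: "'a measure" and X :: "'a \<Rightarrow> real"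
    and \<phi>1 \<phi>2 \<phi>3 :: "real \<Rightarrow> ennreal" and r :: real
  assumes "prob_space P0"
    and "integrable P0 X"
    and "\<phi>1 \<in> Phi0" and "\<phi>2 \<in> Phi0" and "\<phi>3 \<in> Phi0"
    and "lower_semicont \<phi>1" and "lower_semicont \<phi>2" and "lower_semicont \<phi>3"
    and "r > 0"
  shows "globalized_robust_oce \<phi>1 \<phi>2 \<phi>3 r P0 X =
    (INF (l, \<theta>1, \<theta>2, \<theta>3) \<in> {0::real..} \<times> (UNIV :: real set) \<times> (UNIV :: real set) \<times> (UNIV :: real set).
       ereal (- \<theta>1 - \<theta>2 - \<theta>3 + l * r)
       + ext_expectation P0 (\<lambda>\<omega>. conjugate_persp \<phi>3 l
           (convex_conjugate \<phi>2 (convex_conjugate \<phi>1 (ereal (\<theta>3 - X \<omega>)) + ereal \<theta>2) + ereal \<theta>1)))"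
    (is "?L = (INF (l, \<theta>1, \<theta>2, \<theta>3) \<in> ?I. ?D l \<theta>1 \<theta>2 \<theta>3)")
proof (rule antisym)
  show "?L \<le> (INF (l, \<theta>1, \<theta>2, \<theta>3) \<in> ?I. ?D l \<theta>1 \<theta>2 \<theta>3)"
    using assms by (auto intro!: INF_greatest globalized_robust_oce_le)
next
  interpret P0: prob_space P0 by fact
  note primal = admissible_le_globalized_robust_oce[OF assms(1,2,6-8)]
  show "(INF (l, \<theta>1, \<theta>2, \<theta>3) \<in> ?I. ?D l \<theta>1 \<theta>2 \<theta>3) \<le> ?L"
  proof (cases "?L = \<infinity>")
    case False
    have "\<phi>1 1 = 0" "\<phi>2 1 = 0" "\<phi>3 1 = 0" using assms by (auto simp: Phi0_def)
    \<comment> \<open>All densities equal to 1 are feasible at no cost and give the finite lower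
      bound -E[X].\<close>
    then have "?L \<noteq> -\<infinity>"
      using primal[OF admissible_const[of \<phi>1 1 \<phi>2 1 \<phi>3 1], of r] \<open>r > 0\<close> by (auto simp: P0.prob_space)
    with False obtain V where V: "?L = ereal V" by (cases ?L) auto
    have le_V: "- (\<integral>\<omega>. y1 \<omega> * X \<omega> \<partial>P0) - (\<integral>\<omega>. k1 \<omega> \<partial>P0) - (\<integral>\<omega>. k2 \<omega> \<partial>P0) \<le> V"
      if "admissible \<phi>1 \<phi>2 \<phi>3 P0 y1 y2 y3 k1 k2 k3" "(\<integral>\<omega>. y1 \<omega> \<partial>P0) = 1"
        "(\<integral>\<omega>. y2 \<omega> \<partial>P0) = 1" "(\<integral>\<omega>. y3 \<omega> \<partial>P0) = 1" "(\<integral>\<omega>. k3 \<omega> \<partial>P0) \<le> r"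
      for y1 y2 y3 k1 k2 k3
      using primal[OF that] unfolding V by simp
    obtain \<theta>1 \<theta>2 \<theta>3 l :: real where l: "l \<ge> 0" and
      mult: "\<And>y1 y2 y3 k1 k2 k3. admissible \<phi>1 \<phi>2 \<phi>3 P0 y1 y2 y3 k1 k2 k3 \<Longrightarrow>
        lagrangian P0 X \<theta>1 \<theta>2 \<theta>3 l y1 y2 y3 k1 k2 k3 \<le> V + \<theta>1 + \<theta>2 + \<theta>3 - l * r"
      by (rule lagrange_multipliers[OF assms(1-5,9), of V], (rule le_V; assumption), rule that)
    have "(INF (l, \<theta>1, \<theta>2, \<theta>3) \<in> ?I. ?D l \<theta>1 \<theta>2 \<theta>3) \<le> ereal V + ereal \<epsilon>" if "\<epsilon> > 0" for \<epsilon>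
    proof -
      \<comment> \<open>The multiplier may vanish, where the convention \<open>0 \<phi>\<^sup>*(s / 0) = \<infinity>\<close> for \<open>s > 0\<close> can exceed
        the limit of \<open>\<lambda> \<phi>\<^sup>*(s / \<lambda>)\<close> as \<open>\<lambda>\<close> tends to \<open>0\<close>; hence the shift to a positive one.\<close>
      define l' where "l' = l + \<epsilon> / r"
      have l': "l' > 0" using l that \<open>r > 0\<close> by (auto simp: l'_def intro: add_nonneg_pos)
      define C where "C = V + \<theta>1 + \<theta>2 + \<theta>3 - l * r"
      have "(INF (l, \<theta>1, \<theta>2, \<theta>3) \<in> ?I. ?D l \<theta>1 \<theta>2 \<theta>3) \<le> ?D l' \<theta>1 \<theta>2 \<theta>3"
        using l' by (intro INF_lower2[of "(l', \<theta>1, \<theta>2, \<theta>3)"]) auto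
      also have "\<dots> \<le> ereal (- \<theta>1 - \<theta>2 - \<theta>3 + l' * r) + ereal C"
      proof (intro add_left_mono dual_value_le[OF assms(1-5) l'])
        fix y1 y2 y3 k1 k2 k3 assume adm: "admissible \<phi>1 \<phi>2 \<phi>3 P0 y1 y2 y3 k1 k2 k3"
        \<comment> \<open>The integral of \<open>k3\<close> is nonnegative, so raising the
          multiplier only lowers the Lagrangian and the same \<open>C\<close> still bounds
          it.\<close>
        then have "l * (\<integral>\<omega>. k3 \<omega> \<partial>P0) \<le> l' * (\<integral>\<omega>. k3 \<omega> \<partial>P0)"
          using that \<open>r > 0\<close> by (intro mult_right_mono integral_nonneg_AE) (auto simp: l'_def admissible_def)
        then show "lagrangian P0 X \<theta>1 \<theta>2 \<theta>3 l' y1 y2 y3 k1 k2 k3 \<le> C"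
          using mult[OF adm] by (simp add: C_def lagrangian_def)
      qed
      \<comment> \<open>The shift by \<open>\<epsilon> / r\<close> raises \<open>l * r\<close> by
        exactly \<open>\<epsilon>\<close>; all other constants cancel against
        \<open>C\<close>.\<close>
      also have "\<dots> = ereal V + ereal \<epsilon>"
        using \<open>r > 0\<close> by (simp add: C_def l'_def field_simps)
      finally show ?thesis .
    qed
    then show ?thesis unfolding V by (rule ereal_le_epsilon2)
  qed simp
qed

end
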